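(* Let $d\ge 3$. Let $G$ be a $2$-connected graph and let $z\in V(G)$. Suppose that $|V(G)|\ge 2d+1$ and $d_G(v)\ge d$ for every $v\in V(G)\setminus\{z\}$. Then $G$ contains a cycle with at least $d(d-2)$ chords.
   Context: All graphs are finite and simple. $d_G(v)$ is the degree of $v$ in $G$. A chord of a cycle $C$ in $G$ is an edge of $G$ joining two vertices of $C$ that are not consecutive on $C$. *)

theory Defs
  imports "Graph_Theory.Graph_Theory"
begin

text \<open>
  Finite simple graphs are the finite symmetric digraphs without loops and parallel arcs
  (the locale \<^locale>\<open>graph\<close>): an undirected edge between u and v is the pair of opposite
  arcs between u and v.  Hence the degree of a vertex is its
  \<^const>\<open>out_degree\<close> (the number of its neighbours), while edges
  must be counted as unordered pairs and not as arcs.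
\<close>

text \<open>
  The induced subgraphs below are nonempty because of the bound on the order; note that
  \<^const>\<open>connected\<close> requires a nonempty vertex set.
\<close>

definition k_connected :: "nat \<Rightarrow> ('a, 'b) pre_digraph \<Rightarrow> bool" where
  "k_connected k G \<longleftrightarrow>
     k < card (verts G) \<and>
     (\<forall>X. X \<subseteq> verts G \<and> card X < k \<longrightarrow> connected (G \<restriction> (verts G - X)))"

text \<open>
  \<^const>\<open>pre_digraph.cycle\<close> counts the walk u, v, u along an edge and back as a cycle, which it
  is not in an undirected graph; the bound on the length excludes exactly these walks.
\<close>

definition undirected_cycle :: "('a, 'b) pre_digraph \<Rightarrow> 'b awalk \<Rightarrow> bool" where
  "undirected_cycle G p \<longleftrightarrow> pre_digraph.cycle G p \<and> 3 \<le> length p"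

definition cycle_verts :: "('a, 'b) pre_digraph \<Rightarrow> 'b awalk \<Rightarrow> 'a set" where
  "cycle_verts G p = tail G ` set p"

definition consecutive_on :: "('a, 'b) pre_digraph \<Rightarrow> 'b awalk \<Rightarrow> 'a \<Rightarrow> 'a \<Rightarrow> bool" where
  "consecutive_on G p u v \<longleftrightarrow> (\<exists>e \<in> set p. {tail G e, head G e} = {u, v})"

definition chords :: "('a, 'b) pre_digraph \<Rightarrow> 'b awalk \<Rightarrow> 'a set set" where
  "chords G p = {{u, v} | u v. u \<rightarrow>\<^bsub>G\<^esub> v \<and> u \<in> cycle_verts G p \<and> v \<in> cycle_verts G p \<and>
                               \<not> consecutive_on G p u v}"

end

theory Submission
  imports Defs
begin

text \<open>
  Consider pairs (A, y) such that G[A] has a Hamiltonian path ending at y and every such path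
  starts at a vertex other than z all of whose neighbours lie in A. A longest path ending at z
  gives such a pair with y = z. If A is smallest possible, then G[A] has a Hamiltonian cycle,
  because a prefix of a path, ending at the last neighbour of its start, is again such a pair.
  It remains to bound the sum of the degrees in G[A] from below. If A is the whole vertex set, this is
  immediate from the bound on the order. Otherwise 2-connectedness yields a vertex x of A other than y
  with a neighbour outside A, so that no Hamiltonian path ending at y starts at x. Take one on which
  the segment X in front of x is shortest, and reroute it to obtain a second, disjoint
  segment L that can be placed in front of x, with X following x in the rerouted path.
  The possible start vertices inside X, those inside L, and the predecessors of the neighbours of a
  start of minimal inner degree are three families of vertices of degree at least d with
  hardly any edges within or between them, and counting their edges off the path gives the bound.
\<close>

subsection \<open>Counting edges off a path\<close>

text \<open>Pairing (u, v) with (v, u) inside the symmetric relation shows that the average weight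
  is at most 1.\<close>

lemma sum_weights_le_card:
  fixes R :: "('a \<times> 'a) set" and c :: "'a \<Rightarrow> 'a \<Rightarrow> int"
  assumes fin: "finite R" and sym: "sym R"
    and le: "\<And>u v. (u, v) \<in> R \<Longrightarrow> c u v + c v u \<le> 2"
  shows "(\<Sum>(u, v)\<in>R. c u v) \<le> int (card R)"
proof -
  have "(\<Sum>(u, v)\<in>R. c u v) = (\<Sum>(u, v)\<in>R. c v u)"
    using sym by (intro sum.reindex_bij_witness[of _ prod.swap prod.swap]) (auto simp: sym_def)
  then have "2 * (\<Sum>(u, v)\<in>R. c u v) = (\<Sum>(u, v)\<in>R. c u v + c v u)"
    by (simp add: sum.distrib split_def)
  also have "\<dots> \<le> (\<Sum>(u, v)\<in>R. 2)"
    using le by (intro sum_mono) auto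
  finally show ?thesis by simp
qed

text \<open>Intended for the set \<open>E\<close> of starts of a segment, with \<open>i v\<close>
  the inner degree of \<open>v\<close> and \<open>s\<close> a start minimising it. If
  \<open>E\<close> is small, \<open>i v \<le> card E\<close> bounds every term, and the resulting
  quadratic in \<open>card E\<close> increases up to \<open>d - 1\<close>; if \<open>E\<close> is
  large, \<open>s\<close> contributes \<open>2 * d - 2 - k\<close> and every other vertex at least
  \<open>d - 2\<close>.\<close>

lemma sum_prefix_degrees_ge:
  fixes i deg :: "'a \<Rightarrow> int" and d k :: int
  assumes fin: "finite E" and s: "s \<in> E" "i s = k"
    and i: "\<And>v. v \<in> E \<Longrightarrow> k \<le> i v" "\<And>v. v \<in> E \<Longrightarrow> i v \<le> int (card E)"
    and deg: "\<And>v. v \<in> E \<Longrightarrow> d \<le> deg v" "\<And>v. v \<in> E \<Longrightarrow> i v \<le> deg v"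
    and k: "1 \<le> k" "k \<le> d" "2 \<le> d"
  shows "k * (2 * d - 2 - k) \<le> (\<Sum>v\<in>E. 2 * deg v - i v - 2)"
proof -
  define e where "e = int (card E)"
  have ke: "k \<le> e" using i[OF s(1)] s(2) by (simp add: e_def)
  show ?thesis
  proof (cases "e \<le> d - 1")
    case True
    have "0 \<le> (e - k) * (2 * d - 2 - e - k)"
      using True ke by (intro mult_nonneg_nonneg) auto
    then have "k * (2 * d - 2 - k) \<le> e * (2 * d - e - 2)"
      by (simp add: algebra_simps)
    also have "\<dots> = (\<Sum>v\<in>E. 2 * d - e - 2)" by (simp add: e_def)
    also have "\<dots> \<le> (\<Sum>v\<in>E. 2 * deg v - i v - 2)"
      using i(2) deg(1) by (intro sum_mono) (force simp: e_def)
    finally show ?thesis .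
  next
    case False
    have t: "d - 2 \<le> 2 * deg v - i v - 2" if "v \<in> E" for v
      using deg[OF that] by linarith
    have "0 \<le> (d - k) * (d - k - 1)"
      by (cases "d = k") (use k in auto)
    then have "k * (2 * d - 2 - k) \<le> (2 * d - 2 - k) + (d - 1) * (d - 2)"
      by (simp add: algebra_simps)
    also have "(d - 1) * (d - 2) \<le> (e - 1) * (d - 2)"
      using False k(3) by (intro mult_right_mono) auto
    also have "(e - 1) * (d - 2) = (\<Sum>v\<in>E - {s}. d - 2)"
      using fin s card_gt_0_iff[of E] by (auto simp: e_def card_Diff_singleton of_nat_diff Suc_leI)
    also have "\<dots> \<le> (\<Sum>v\<in>E - {s}. 2 * deg v - i v - 2)"
      using t by (intro sum_mono) auto
    also have "2 * d - 2 - k + (\<Sum>v\<in>E - {s}. 2 * deg v - i v - 2)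
        \<le> (2 * deg s - i s - 2) + (\<Sum>v\<in>E - {s}. 2 * deg v - i v - 2)"
      using deg(1)[OF s(1)] s(2) by simp
    also have "\<dots> = (\<Sum>v\<in>E. 2 * deg v - i v - 2)"
      using fin s(1) by (simp add: sum.remove)
    finally show ?thesis by simp
  qed
qed

lemma sum_one_two:
  assumes "finite B"
  shows "(\<Sum>v\<in>B. if v \<in> Z then 1 else 2 :: int) = 2 * int (card B) - int (card (B \<inter> Z))"
proof -
  have "(\<Sum>v\<in>B. if v \<in> Z then 1 else 2 :: int) = (\<Sum>v\<in>B. 2 - (if v \<in> Z then 1 else 0))"
    by (rule sum.cong) auto
  also have "\<dots> = 2 * int (card B) - int (card (B \<inter> Z))"
    using assms by (simp add: sum_subtractf sum.inter_restrict[symmetric])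
  finally show ?thesis .
qed

text \<open>
  Here pn u is the set of neighbours of u on a Hamiltonian path. An ordered pair of adjacent vertices
  (u, v) off the path gets a weight c u v with c u v + c v u at most 2: the set W' (a part of W of size
  d - k) sends 2 to everything, E1 sends 1 inside Z1 and 2 outside, and E2 sends nothing to W',
  1 inside Z2 and 2 otherwise.
\<close>

lemma degree_sum_ge:
  fixes N pn :: "'a \<Rightarrow> 'a set" and d k :: nat
  assumes finA: "finite A" and NA: "\<And>u. N u \<subseteq> A" and symN: "\<And>u v. v \<in> N u \<Longrightarrow> u \<in> N v"
    and pN: "\<And>u. pn u \<subseteq> N u" and symP: "\<And>u v. v \<in> pn u \<Longrightarrow> u \<in> pn v"
    and p2: "\<And>u. card (pn u) \<le> 2" and psum: "2 * int (card A) - 2 \<le> (\<Sum>u\<in>A. int (card (pn u)))"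
    and sub: "W \<subseteq> A" "E1 \<subseteq> A" "E2 \<subseteq> A" "E1 \<subseteq> Z1" "E2 \<subseteq> Z2"
    and disj: "E1 \<inter> E2 = {}" "W \<inter> E1 = {}"
    and s: "s \<in> E1" "card (pn s) \<le> 1" "card (N s \<inter> Z1) = k"
    and pE1: "\<And>v. v \<in> E1 \<Longrightarrow> pn v \<subseteq> Z1"
    and i1: "\<And>v. v \<in> E1 \<Longrightarrow> k \<le> card (N v \<inter> Z1) \<and> card (N v \<inter> Z1) \<le> card E1"
    and i2: "\<And>v. v \<in> E2 \<Longrightarrow> k \<le> card (N v \<inter> Z2) \<and> card (N v \<inter> Z2) \<le> card E2"
    and ne: "E2 \<noteq> {}"
    and W: "d \<le> card W + k" "\<And>u v. u \<in> W \<Longrightarrow> v \<in> W \<Longrightarrow> v \<notin> N u"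
    and WE: "\<And>u v. u \<in> W \<Longrightarrow> v \<in> E1 \<Longrightarrow> v \<notin> N u"
    and EE: "\<And>u v. u \<in> E1 \<Longrightarrow> v \<in> E2 \<Longrightarrow> v \<notin> N u"
    and WZ: "W \<inter> Z2 \<subseteq> {w}"
    and rich: "\<And>v. v \<in> W \<union> E1 \<union> E2 \<Longrightarrow> d \<le> card (N v)"
    and alt: "(\<forall>v\<in>E2. k < card (N v \<inter> Z2)) \<or> (\<forall>v\<in>E2 - {w}. pn v \<subseteq> Z2)"
    and k: "1 \<le> k" and d: "2 \<le> d"
  shows "2 * int (card A) + 2 * int d * (int d - 2) \<le> (\<Sum>u\<in>A. int (card (N u))) + 1"
proof -
  \<comment> \<open>For \<open>k > d\<close> the truncated difference makes \<open>W'\<close> empty;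
    that case is treated separately at the end.\<close>
  obtain W' where W': "W' \<subseteq> W" "card W' = d - k"
    using W(1) by (meson obtain_subset_with_card_n le_diff_conv)
  define c where "c u v = (if u \<in> W' then 2 else if u \<in> E1 then if v \<in> Z1 then 1 else 2
     else if u \<in> E2 then if v \<in> W' then 0 else if v \<in> Z2 then 1 else 2 else 0 :: int)" for u v
  define B where "B u = N u - pn u" for u
  define F where "F = Sigma A B"
  define S where "S u = (\<Sum>v\<in>B u. c u v)" for u
  have finN: "finite (N u)" "finite (pn u)" "finite (B u)" for u
    using finA NA[of u] pN[of u] by (auto simp: B_def intro: finite_subset)
  have finW: "finite W'" "finite E1" "finite E2"
    by (meson sub W' finA finite_subset subset_trans)+
  have cB: "int (card (B u)) = int (card (N u)) - int (card (pn u))" for u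
    using finN pN[of u] by (simp add: B_def card_Diff_subset of_nat_diff card_mono)
  have symF: "sym F"
    using symN symP NA by (fastforce simp: F_def B_def sym_def)
  \<comment> \<open>No edges run inside \<open>W\<close>, from \<open>W\<close> to \<open>E1\<close>
    or from \<open>E1\<close> to \<open>E2\<close>. Inside \<open>E1\<close>, and inside
    \<open>E2\<close> off \<open>W'\<close>, each direction weighs 1, and the 2 sent from
    \<open>W'\<close> into \<open>E2\<close> meets a 0 coming back.\<close>
  have cle: "c u v + c v u \<le> 2" if "(u, v) \<in> F" for u v
  proof -
    have uv: "v \<in> N u" "u \<in> N v" using that symN by (auto simp: F_def B_def)
    show ?thesis
      using uv W(2)[of u v] W(2)[of v u] WE[of u v] WE[of v u] EE[of u v] EE[of v u] W'(1) sub(4,5) disj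
      by (auto simp: c_def)
  qed
  have "finite F" using finA finN by (simp add: F_def)
  then have "(\<Sum>(u, v)\<in>F. c u v) \<le> int (card F)"
    using symF cle by (rule sum_weights_le_card)
  also have "(\<Sum>(u, v)\<in>F. c u v) = (\<Sum>u\<in>A. S u)"
    using finA finN by (simp add: F_def S_def sum.Sigma)
  also have "int (card F) = (\<Sum>u\<in>A. int (card (N u))) - (\<Sum>u\<in>A. int (card (pn u)))"
    using finA finN cB by (simp add: F_def sum_subtractf)
  finally have up: "(\<Sum>u\<in>A. S u) \<le> (\<Sum>u\<in>A. int (card (N u))) - (2 * int (card A) - 2)"
    using psum by linarith
  have S0: "0 \<le> S u" for u unfolding S_def c_def by (rule sum_nonneg) auto
  \<comment> \<open>\<open>W'\<close> and \<open>E2\<close> may share the vertex \<open>w\<close>,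
    so \<open>E2\<close> is counted without \<open>W'\<close>.\<close>
  have "(\<Sum>u\<in>W'. S u) + (\<Sum>u\<in>E1. S u) + (\<Sum>u\<in>E2 - W'. S u) = (\<Sum>u\<in>W' \<union> E1 \<union> (E2 - W'). S u)"
    using finW disj W'(1) by (subst sum.union_disjoint; (subst sum.union_disjoint)?) auto
  also have "\<dots> \<le> (\<Sum>u\<in>A. S u)"
    using finA sub W'(1) S0 by (intro sum_mono2) auto
  finally have low: "(\<Sum>u\<in>W'. S u) + (\<Sum>u\<in>E1. S u) + (\<Sum>u\<in>E2 - W'. S u) \<le> (\<Sum>u\<in>A. S u)" .

  have SW: "2 * (int d - 2) \<le> S u" if "u \<in> W'" for u
  proof -
    have "S u = 2 * int (card (B u))" using that by (simp add: S_def c_def)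
    moreover have "int d \<le> int (card (N u))" using rich[of u] that W'(1) by auto
    moreover have "int (card (pn u)) \<le> 2" using p2[of u] by simp
    ultimately show ?thesis using cB[of u] by simp
  qed
  have sumW: "2 * (int d - 2) * int (card W') \<le> (\<Sum>u\<in>W'. S u)"
    using sum_mono[of W' "\<lambda>_. 2 * (int d - 2)" S] SW by (simp add: mult.commute)

  \<comment> \<open>The path neighbours of \<open>u\<close> lie in \<open>Z1\<close>, so leaving
    them out costs only 1 each.\<close>
  have SE1: "S u = 2 * int (card (N u)) - int (card (N u \<inter> Z1)) - int (card (pn u))" if u: "u \<in> E1" for u
  proof -
    have "u \<notin> W'" using u W'(1) disj by auto
    then have "S u = 2 * int (card (B u)) - int (card (B u \<inter> Z1))"
      using u finN by (simp add: S_def c_def sum_one_two)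
    moreover have "B u \<inter> Z1 = N u \<inter> Z1 - pn u" by (auto simp: B_def)
    then have "int (card (B u \<inter> Z1)) = int (card (N u \<inter> Z1)) - int (card (pn u))"
      using finN pN[of u] pE1[OF u] by (simp add: card_Diff_subset of_nat_diff card_mono)
    ultimately show ?thesis using cB[of u] by linarith
  qed
  \<comment> \<open>\<open>T\<close> charges every vertex for two path neighbours. The start
    \<open>s\<close> has at most one, and this surplus of 1 leaves an error of only 1 in the
    conclusion, which parity can absorb later.\<close>
  define T where "T u = 2 * int (card (N u)) - int (card (N u \<inter> Z1)) - 2" for u
  have "(\<Sum>u\<in>E1. T u + (if u = s then 1 else 0)) \<le> (\<Sum>u\<in>E1. S u)"
    using SE1 p2 s(2) by (intro sum_mono) (force simp: T_def)
  then have sumE1: "(\<Sum>u\<in>E1. T u) + 1 \<le> (\<Sum>u\<in>E1. S u)"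
    using finW s(1) by (simp add: sum.distrib)

  have SE2: "S u = int (card (B u - W')) + int (card (B u - W' - Z2))" if u: "u \<in> E2 - W'" for u
  proof -
    have "u \<notin> E1" using u disj by auto
    then have "S u = (\<Sum>v\<in>B u. if v \<in> W' then 0 else if v \<in> Z2 then 1 else 2)"
      using u by (simp add: S_def c_def)
    also have "\<dots> = (\<Sum>v\<in>B u - W'. if v \<in> Z2 then 1 else 2)"
      using finN by (intro sum.mono_neutral_cong_right) auto
    also have "\<dots> = 2 * int (card (B u - W')) - int (card ((B u - W') \<inter> Z2))"
      using finN by (simp add: sum_one_two)
    also have "int (card (B u - W')) = int (card ((B u - W') \<inter> Z2)) + int (card (B u - W' - Z2))"
      using finN by (metis card_Int_Diff finite_Diff of_nat_add)
    finally show ?thesis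
      using finN by (simp add: card_Int_Diff[of "B u - W'" Z2])
  qed
  have SE2': "int (card (N u \<inter> Z2)) - 2 - int (card (W' \<inter> Z2)) + 2 * int (card (B u - W' - Z2)) \<le> S u"
    if u: "u \<in> E2 - W'" for u
  proof -
    have "card (N u \<inter> Z2) \<le> card ((B u - W') \<inter> Z2 \<union> pn u \<union> (W' \<inter> Z2))"
      using finN finW by (intro card_mono) (auto simp: B_def)
    also have "\<dots> \<le> card ((B u - W') \<inter> Z2) + card (pn u) + card (W' \<inter> Z2)"
      by (meson card_Un_le add_le_mono le_refl order_trans)
    finally have "int (card (N u \<inter> Z2)) - 2 - int (card (W' \<inter> Z2)) \<le> int (card ((B u - W') \<inter> Z2))"
      using p2[of u] by linarith
    then show ?thesis
      using SE2[OF u] finN by (simp add: card_Int_Diff[of "B u - W'" Z2])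
  qed
  have kE2: "k \<le> card E2" using ne i2 by (meson ex_in_conv le_trans)
  \<comment> \<open>The aim is \<open>k\<close> vertices contributing \<open>k - 2\<close> each; for
    \<open>k = 1\<close> the bound is negative. Only \<open>w\<close> can interfere, as it may drop
    out of \<open>E2\<close> and also cost every other vertex one unit; \<open>alt\<close>
    compensates for this.\<close>
  have sumE2: "int k * (int k - 2) \<le> (\<Sum>u\<in>E2 - W'. S u)"
  proof (cases "k = 1")
    case True
    moreover have "0 \<le> (\<Sum>u\<in>E2 - W'. S u)" using S0 by (simp add: sum_nonneg)
    ultimately show ?thesis by simp
  next
    case False
    have below: ?thesis if n: "m \<le> card (E2 - W')" and t: "\<And>u. u \<in> E2 - W' \<Longrightarrow> t \<le> S u"
      and g: "0 \<le> t" "int k * (int k - 2) \<le> int m * t" for m :: nat and t :: int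
    proof -
      have "int m * t \<le> int (card (E2 - W')) * t" using n g by (intro mult_right_mono) auto
      also have "\<dots> \<le> (\<Sum>u\<in>E2 - W'. S u)"
        using sum_mono[of "E2 - W'" "\<lambda>_. t" S] t by simp
      finally show ?thesis using g(2) by linarith
    qed
    show ?thesis
    proof (cases "w \<in> W' \<inter> Z2")
      case w: False
      then have e: "W' \<inter> Z2 = {}" "E2 - W' = E2" using WZ W'(1) sub(5) by auto
      show ?thesis
      proof (rule below[of k "int k - 2"])
        fix u assume u: "u \<in> E2 - W'"
        then have "int k \<le> int (card (N u \<inter> Z2))" using i2 by auto
        then show "int k - 2 \<le> S u" using SE2'[OF u] e by simp
      qed (use e kE2 k False in auto)
    next
      case w: True
      have e: "card (W' \<inter> Z2) \<le> 1"
        using WZ W'(1) by (metis card.empty card_insert_le card_mono finite.emptyI finite.insertI inf_mono is_singletonI is_singleton_altdef order.trans order_refl)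
      have e2: "E2 - {w} \<subseteq> E2 - W'" using WZ W'(1) sub(5) by auto
      have c2: "card E2 - 1 \<le> card (E2 - W')"
        using card_mono[OF _ e2] finW by (metis card_Diff_singleton_if diff_le_self finite_Diff le_trans)
      have base: "int (card (N u \<inter> Z2)) - 3 + 2 * int (card (B u - W' - Z2)) \<le> S u" if "u \<in> E2 - W'" for u
        using SE2'[OF that] e by linarith
      show ?thesis
      \<comment> \<open>Inner degrees above \<open>k\<close> throughout give one more vertex in
        \<open>E2\<close> and one more unit per vertex, offsetting both losses.\<close>
      proof (cases "\<forall>v\<in>E2. k < card (N v \<inter> Z2)")
        case True
        show ?thesis
        proof (rule below[of k "int k - 2"])
          obtain v where "v \<in> E2" using ne by auto
          then have "k < card E2" using True i2 by (meson le_trans less_le_trans)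
          then show "k \<le> card (E2 - W')" using c2 by linarith
        next
          fix u assume u: "u \<in> E2 - W'"
          then have "int k + 1 \<le> int (card (N u \<inter> Z2))" using True by (auto simp: Suc_le_eq[symmetric])
          then show "int k - 2 \<le> S u" using base[OF u] by linarith
        qed (use k False in auto)
      next
        case F: False
        then have P: "pn v \<subseteq> Z2" if "v \<in> E2 - W'" for v using alt w that by auto
        \<comment> \<open>All neighbours of \<open>u\<close> outside \<open>Z2\<close> are off the
          path, and at most \<open>d - k - 1\<close> of them lie in \<open>W'\<close> because
          \<open>w\<close> is in \<open>Z2\<close>. The degree bound supplies the others.\<close>
        have out: "int k + 1 - int (card (N u \<inter> Z2)) \<le> int (card (B u - W' - Z2))" if u: "u \<in> E2 - W'" for u
        proof -
          have "N u - Z2 \<subseteq> (B u - W' - Z2) \<union> (W' - {w})"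
            using P[OF u] WZ W'(1) w by (auto simp: B_def)
          then have "card (N u - Z2) \<le> card ((B u - W' - Z2) \<union> (W' - {w}))"
            using finN finW by (intro card_mono) auto
          also have "\<dots> \<le> card (B u - W' - Z2) + card (W' - {w})" by (rule card_Un_le)
          finally have "card (N u - Z2) \<le> card (B u - W' - Z2) + (d - k - 1)"
            using w W'(2) finW by simp
          moreover have "1 \<le> d - k" using w W'(2) card_gt_0_iff[of W'] finW by auto
          moreover have "d \<le> card (N u)" using rich[of u] u by auto
          moreover have "card (N u) = card (N u \<inter> Z2) + card (N u - Z2)"
            using finN by (simp add: card_Int_Diff)
          ultimately show ?thesis by linarith
        qed
        show ?thesis
        \<comment> \<open>If all inner degrees equal \<open>k\<close>, \<open>out\<close> gives each
          vertex an edge of weight 2, and \<open>k - 1\<close> vertices with \<open>k - 1\<close>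
          each suffice. Otherwise a larger inner degree forces \<open>card E2 > k\<close>, so
          \<open>k\<close> vertices remain without \<open>w\<close>.\<close>
        proof (cases "\<forall>v\<in>E2 - W'. card (N v \<inter> Z2) = k")
          case True
          show ?thesis
          proof (rule below[of "k - 1" "int k - 1"])
            fix u assume u: "u \<in> E2 - W'"
            then show "int k - 1 \<le> S u" using base[OF u] out[OF u] True by auto
          next
            show "int k * (int k - 2) \<le> int (k - 1) * (int k - 1)"
              using k by (simp add: of_nat_diff algebra_simps)
          qed (use k kE2 c2 in auto)
        next
          case False2: False
          then obtain v where v: "v \<in> E2 - W'" "k < card (N v \<inter> Z2)"
            using i2 by (metis DiffD1 order_le_imp_less_or_eq)
          show ?thesis
          proof (rule below[of k "int k - 2"])
            have "k < card E2" using v i2[of v] by auto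
            then show "k \<le> card (E2 - W')" using c2 by linarith
          next
            fix u assume u: "u \<in> E2 - W'"
            then have "k \<le> card (N u \<inter> Z2)" using i2 by auto
            then show "int k - 2 \<le> S u" using base[OF u] out[OF u] by linarith
          qed (use k False in auto)
        qed
      qed
    qed
  qed

  \<comment> \<open>For \<open>k \<le> d\<close> the bounds \<open>2 * (d - 2) * (d - k)\<close>,
    \<open>k * (2 * d - 2 - k) + 1\<close> and \<open>k * (k - 2)\<close> add up exactly to the left
    side. For \<open>k > d\<close>, \<open>E1\<close> and \<open>E2\<close> alone give at least
    \<open>k * (k - 2)\<close> each.\<close>
  have "2 * int d * (int d - 2) + 1 \<le> (\<Sum>u\<in>W'. S u) + (\<Sum>u\<in>E1. S u) + (\<Sum>u\<in>E2 - W'. S u)"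
  proof (cases "k \<le> d")
    case True
    have "int k * (2 * int d - 2 - int k) \<le> (\<Sum>u\<in>E1. T u)"
      unfolding T_def
    proof (rule sum_prefix_degrees_ge[where s = s])
      fix v assume "v \<in> E1"
      then show "int (card (N v \<inter> Z1)) \<le> int (card (N v))"
        using finN by (simp add: card_mono)
    qed (use finW s i1 rich k d True in auto)
    then show ?thesis
      using sumW sumE1 sumE2 True W'(2) by (simp add: of_nat_diff algebra_simps)
  next
    case False
    have "int k - 2 \<le> T u" if "u \<in> E1" for u
    proof -
      have "card (N u \<inter> Z1) \<le> card (N u)" using finN by (simp add: card_mono)
      moreover have "k \<le> card (N u \<inter> Z1)" using i1 that by auto
      ultimately show ?thesis unfolding T_def by linarith
    qed
    then have "int (card E1) * (int k - 2) \<le> (\<Sum>u\<in>E1. T u)"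
      using sum_mono[of E1 "\<lambda>_. int k - 2" T] by simp
    moreover have "int k * (int k - 2) \<le> int (card E1) * (int k - 2)"
      using i1[OF s(1)] False d by (intro mult_right_mono) auto
    moreover have "0 \<le> (\<Sum>u\<in>W'. S u)" using S0 by (simp add: sum_nonneg)
    moreover have "int d * (int d - 2) \<le> int k * (int k - 2)"
      using False d by (intro mult_mono) auto
    ultimately show ?thesis using sumE1 sumE2 by linarith
  qed
  then show ?thesis using low up by linarith
qed

subsection \<open>Paths as lists of vertices\<close>

definition consec :: "'a list \<Rightarrow> ('a \<times> 'a) set" where
  "consec P = set (zip P (tl P))"

lemma consec_iff: "(u, v) \<in> consec P \<longleftrightarrow> (\<exists>as bs. P = as @ u # v # bs)"
proof
  assume "(u, v) \<in> consec P"
  then obtain i where "i < length (tl P)" "P ! i = u" "tl P ! i = v"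
    unfolding consec_def in_set_zip by auto
  then have i: "Suc i < length P" "P ! i = u" "P ! Suc i = v"
    by (auto simp: nth_tl)
  then have "P = take i P @ u # v # drop (Suc (Suc i)) P"
    by (metis Cons_nth_drop_Suc Suc_lessD id_take_nth_drop)
  then show "\<exists>as bs. P = as @ u # v # bs" by blast
next
  assume "\<exists>as bs. P = as @ u # v # bs"
  then obtain as bs where P: "P = as @ u # v # bs" by blast
  then have "P ! length as = u" "tl P ! length as = v" "length as < length (tl P)"
    by (auto simp: nth_append nth_tl)
  then show "(u, v) \<in> consec P" unfolding consec_def in_set_zip
    by (intro exI[of _ "length as"]) auto
qed

lemma consec_succ_eq:
  assumes "distinct (as @ v # bs)" "(v, u) \<in> consec (as @ v # bs)"
  shows "bs \<noteq> [] \<and> u = hd bs"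
proof -
  obtain cs ds where "as @ v # bs = cs @ v # u # ds" using assms(2) by (auto simp: consec_iff)
  then have "bs = u # ds" using assms(1) by (subst (asm) append_Cons_eq_iff) auto
  then show ?thesis by simp
qed

lemma consec_pred_eq:
  assumes "distinct (as @ v # bs)" "(u, v) \<in> consec (as @ v # bs)"
  shows "as \<noteq> [] \<and> u = last as"
proof -
  obtain cs ds where "as @ v # bs = (cs @ [u]) @ v # ds" using assms(2) by (auto simp: consec_iff)
  then have "as = cs @ [u]" using assms(1) by (subst (asm) append_Cons_eq_iff) auto
  then show ?thesis by simp
qed

lemma consec_unique:
  assumes "distinct P"
  shows "(u, v) \<in> consec P \<Longrightarrow> (u, v') \<in> consec P \<Longrightarrow> v = v'"
    and "(u, v) \<in> consec P \<Longrightarrow> (u', v) \<in> consec P \<Longrightarrow> u = u'"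
proof -
  assume "(u, v) \<in> consec P" "(u, v') \<in> consec P"
  moreover then obtain as bs where "P = as @ u # bs" by (auto simp: consec_iff)
  ultimately show "v = v'" using assms consec_succ_eq by metis
next
  assume a: "(u, v) \<in> consec P" "(u', v) \<in> consec P"
  then obtain as bs where "P = (as @ [u]) @ v # bs" by (auto simp: consec_iff)
  with a show "u = u'" using assms consec_pred_eq by metis
qed

lemma consec_set: "(u, v) \<in> consec P \<Longrightarrow> u \<in> set P \<and> v \<in> set P"
  by (auto simp: consec_iff)

lemma finite_consec: "finite (consec P)"
  by (simp add: consec_def)

lemma card_consec: "distinct P \<Longrightarrow> card (consec P) = length P - 1"
  by (simp add: consec_def distinct_card distinct_zipI1)

lemma consec_asym:
  assumes "distinct P" "(u, v) \<in> consec P" shows "(v, u) \<notin> consec P"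
proof
  assume "(v, u) \<in> consec P"
  moreover obtain as bs where P: "P = as @ u # v # bs" using assms(2) by (auto simp: consec_iff)
  ultimately have "v \<in> set as" using consec_pred_eq[of as u "v # bs" v] assms(1) by (metis last_in_set)
  then show False using P assms(1) by auto
qed

definition path_nbrs :: "'a list \<Rightarrow> 'a \<Rightarrow> 'a set" where
  "path_nbrs P v = {u. (u, v) \<in> consec P \<or> (v, u) \<in> consec P}"

lemma path_nbrs_sym: "u \<in> path_nbrs P v \<Longrightarrow> v \<in> path_nbrs P u"
  by (auto simp: path_nbrs_def)

lemma path_nbrs_subset:
  assumes "distinct (as @ v # bs)"
  shows "path_nbrs (as @ v # bs) v \<subseteq> (if as = [] then {} else {last as}) \<union> (if bs = [] then {} else {hd bs})"
proof
  fix u assume "u \<in> path_nbrs (as @ v # bs) v"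
  then have "(u, v) \<in> consec (as @ v # bs) \<or> (v, u) \<in> consec (as @ v # bs)"
    by (simp add: path_nbrs_def)
  then have "as \<noteq> [] \<and> u = last as \<or> bs \<noteq> [] \<and> u = hd bs"
    using consec_pred_eq[OF assms] consec_succ_eq[OF assms] by blast
  then show "u \<in> (if as = [] then {} else {last as}) \<union> (if bs = [] then {} else {hd bs})" by auto
qed

lemma card_path_nbrs_le:
  assumes "distinct P"
  shows "card (path_nbrs P v) \<le> 2"
proof (cases "v \<in> set P")
  case True
  then obtain as bs where P: "P = as @ v # bs" by (meson split_list)
  have "card (path_nbrs P v) \<le> card ({last as} \<union> {hd bs})"
    using path_nbrs_subset[of as v bs] P assms by (intro card_mono) (auto split: if_splits)
  also have "\<dots> \<le> 2" by (simp add: card_insert_if)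
  finally show ?thesis .
next
  case False
  then have "path_nbrs P v = {}" by (auto simp: path_nbrs_def dest: consec_set)
  then show ?thesis by simp
qed

lemma card_path_nbrs_hd:
  assumes "distinct (v # P)"
  shows "card (path_nbrs (v # P) v) \<le> 1"
proof -
  have "card (path_nbrs (v # P) v) \<le> card {hd P}"
    using path_nbrs_subset[of "[]" v P] assms by (intro card_mono) (auto split: if_splits)
  then show ?thesis by simp
qed

text \<open>Handshake count: the neighbour relation of the path is the disjoint union of
  \<open>consec P\<close> and its converse.\<close>

lemma sum_card_path_nbrs:
  assumes "distinct P" "P \<noteq> []"
  shows "(\<Sum>v\<in>set P. int (card (path_nbrs P v))) = 2 * int (card (set P)) - 2"
proof -
  have sg: "Sigma (set P) (path_nbrs P) = consec P \<union> (consec P)\<inverse>"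
    by (auto simp: path_nbrs_def dest: consec_set)
  have fin: "finite (path_nbrs P v)" for v
    by (rule finite_subset[of _ "set P"]) (auto simp: path_nbrs_def dest: consec_set)
  have "(\<Sum>v\<in>set P. card (path_nbrs P v)) = card (Sigma (set P) (path_nbrs P))"
    using fin by simp
  also have "\<dots> = card (consec P) + card ((consec P)\<inverse>)"
    unfolding sg using consec_asym[OF assms(1)] by (intro card_Un_disjoint) (auto simp: finite_consec)
  also have "\<dots> = 2 * (length P - 1)" using assms(1) by (simp add: card_consec)
  finally have e: "(\<Sum>v\<in>set P. card (path_nbrs P v)) = 2 * (length P - 1)" .
  have "(\<Sum>v\<in>set P. int (card (path_nbrs P v))) = int (\<Sum>v\<in>set P. card (path_nbrs P v))"
    by (rule of_nat_sum[symmetric])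
  also have "\<dots> = 2 * int (card (set P)) - 2"
    unfolding e using assms by (cases P) (auto simp: distinct_card card_insert_if)
  finally show ?thesis .
qed

text \<open>The relation is kept abstract because the path arguments apply both to the whole graph
  and to an induced subgraph.\<close>

locale sym_adjacency =
  fixes adj :: "'a \<Rightarrow> 'a \<Rightarrow> bool"
  assumes adj_commute: "adj u v \<longleftrightarrow> adj v u" and not_adj_self: "\<not> adj v v"
begin

definition nbrs :: "'a \<Rightarrow> 'a set" where "nbrs v = {u. adj v u}"

definition is_path :: "'a list \<Rightarrow> bool" where
  "is_path xs \<longleftrightarrow> distinct xs \<and> successively adj xs"

lemma is_path_append: "is_path (xs @ ys) \<longleftrightarrow>
    is_path xs \<and> is_path ys \<and> set xs \<inter> set ys = {} \<and> (xs = [] \<or> ys = [] \<or> adj (last xs) (hd ys))"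
  by (auto simp: is_path_def successively_append_iff)

lemma is_path_Cons: "is_path (u # xs) \<longleftrightarrow> u \<notin> set xs \<and> is_path xs \<and> (xs = [] \<or> adj u (hd xs))"
  by (auto simp: is_path_def successively_Cons)

lemma is_path_Nil: "is_path []"
  by (simp add: is_path_def)

lemma is_path_rev: "is_path (rev xs) \<longleftrightarrow> is_path xs"
proof -
  have "successively (\<lambda>u v. adj v u) xs = successively adj xs"
    by (rule successively_cong) (use adj_commute in auto)
  then show ?thesis unfolding is_path_def successively_rev distinct_rev by simp
qed

lemmas is_path_simps = is_path_append is_path_Cons is_path_Nil is_path_rev hd_append last_append hd_rev last_rev

lemma is_path_distinct: "is_path xs \<Longrightarrow> distinct xs"
  by (simp add: is_path_def)

lemma consec_adj: "is_path P \<Longrightarrow> (u, v) \<in> consec P \<Longrightarrow> adj u v"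
  by (auto simp: consec_iff is_path_simps)

lemma path_nbrs_adj: "is_path P \<Longrightarrow> path_nbrs P v \<subseteq> nbrs v"
  using consec_adj[of P] adj_commute unfolding path_nbrs_def nbrs_def by blast

end

subsection \<open>Hamiltonian paths through a vertex that is never a start\<close>

text \<open>Models the induced subgraph on \<open>A\<close>; \<open>x\<close> is to be the vertex at
  which no Hamiltonian path ending at \<open>y\<close> starts.\<close>

locale ham_core = sym_adjacency +
  fixes A :: "'a set" and x y :: 'a and d :: nat
  assumes finite_A: "finite A" and adj_A: "adj u v \<Longrightarrow> u \<in> A"
    and x_A: "x \<in> A" and x_y: "x \<noteq> y" and two_le_d: "2 \<le> d"
begin

definition ham :: "'a list \<Rightarrow> bool" where
  "ham xs \<longleftrightarrow> is_path xs \<and> set xs = A \<and> last xs = y"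

text \<open>These are the segments that may stand in front of \<open>x\<close>; any two with the
  same vertex set are interchangeable without touching the rest of the path
  (\<open>ham_swap\<close>).\<close>

definition xpath :: "'a set \<Rightarrow> 'a list \<Rightarrow> bool" where
  "xpath X vs \<longleftrightarrow> vs \<noteq> [] \<and> set vs = X \<and> is_path vs \<and> adj (last vs) x"

definition xends :: "'a set \<Rightarrow> 'a set" where
  "xends X = hd ` {vs. xpath X vs}"

text \<open>
  On a path us @ x # pre @ ps with first vertex u0, these are the predecessors in pre @ ps of the
  neighbours of u0 in ps; reversing the part in between makes each of them a start.
\<close>

definition pre_nbrs :: "'a \<Rightarrow> 'a list \<Rightarrow> 'a list \<Rightarrow> 'a set" where
  "pre_nbrs u0 pre ps = {last (pre @ cs) | cs u bs. ps = cs @ u # bs \<and> adj u0 u \<and> pre @ cs \<noteq> []}"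

lemma nbrs_A: "nbrs v \<subseteq> A" "finite (nbrs v)"
proof -
  show "nbrs v \<subseteq> A" using adj_A adj_commute by (auto simp: nbrs_def)
  then show "finite (nbrs v)" using finite_A by (rule finite_subset)
qed

section \<open>Segments in front of x and their starts\<close>

lemma xends_subset: "xends X \<subseteq> X"
  by (auto simp: xends_def xpath_def)

lemma ham_swap: "ham (us @ x # ps) \<Longrightarrow> us \<noteq> [] \<Longrightarrow> xpath (set us) vs \<Longrightarrow> ham (vs @ x # ps)"
  by (auto simp: ham_def xpath_def is_path_simps)

lemma ham_xpath: "ham (us @ x # ps) \<Longrightarrow> us \<noteq> [] \<Longrightarrow> xpath (set us) us"
  by (auto simp: ham_def xpath_def is_path_simps)

lemma xpath_distinct: "xpath X vs \<Longrightarrow> x \<notin> X \<Longrightarrow> is_path (vs @ [x])"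
  by (auto simp: xpath_def is_path_simps)

lemma xpath_card_ge:
  assumes "xpath X vs" "x \<notin> X"
  shows "1 \<le> card (nbrs (hd vs) \<inter> insert x X)"
proof -
  have "hd (tl (vs @ [x])) \<in> nbrs (hd vs) \<inter> insert x X"
    using assms by (cases vs; cases "tl vs") (auto simp: xpath_def nbrs_def is_path_simps)
  then show ?thesis
    using nbrs_A by (metis One_nat_def Suc_leI card_gt_0_iff empty_iff finite_Int)
qed

text \<open>Rotation: for a neighbour \<open>u\<close> of the start, reversing the part of
  \<open>vs @ [x]\<close> before \<open>u\<close> makes the predecessor of \<open>u\<close> a start,
  and distinct neighbours have distinct predecessors. For \<open>u = x\<close> all of
  \<open>vs\<close> is reversed.\<close>

lemma xpath_card_le:
  assumes vs: "xpath X vs" and x: "x \<notin> X"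
  shows "card (nbrs (hd vs) \<inter> insert x X) \<le> card (xends X)"
proof (rule card_le_if_inj_on_rel[where r = "\<lambda>u p. (p, u) \<in> consec (vs @ [x])"])
  show "finite (xends X)"
    using xends_subset vs by (metis List.finite_set finite_subset xpath_def)
next
  fix u assume u: "u \<in> nbrs (hd vs) \<inter> insert x X"
  then have ne: "u \<noteq> hd vs" using not_adj_self by (auto simp: nbrs_def)
  show "\<exists>p. p \<in> xends X \<and> (p, u) \<in> consec (vs @ [x])"
  proof (cases "u = x")
    case True
    have "xpath X (rev vs)"
      using vs u True by (auto simp: xpath_def is_path_simps nbrs_def)
    then have "last vs \<in> xends X" using vs by (force simp: xends_def xpath_def hd_rev)
    moreover have "(last vs, u) \<in> consec (vs @ [x])"
      using vs True unfolding consec_iff xpath_def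
      by (intro exI[of _ "butlast vs"] exI[of _ "[]"]) simp
    ultimately show ?thesis by blast
  next
    case False
    then have "u \<in> set vs" using u vs by (auto simp: xpath_def)
    then obtain as bs where v: "vs = as @ u # bs" by (meson split_list)
    then have as: "as \<noteq> []" using ne by auto
    have "xpath X (rev as @ u # bs)"
      using vs u v as by (auto simp: xpath_def is_path_simps nbrs_def)
    then have "last as \<in> xends X" using as by (force simp: xends_def hd_rev)
    moreover have "(last as, u) \<in> consec (vs @ [x])"
      using v as unfolding consec_iff
      by (intro exI[of _ "butlast as"] exI[of _ "bs @ [x]"]) simp
    ultimately show ?thesis by blast
  qed
next
  fix u u' p
  assume "(p, u) \<in> consec (vs @ [x])" "(p, u') \<in> consec (vs @ [x])"
  then show "u = u'" using consec_unique(1) is_path_distinct[OF xpath_distinct[OF vs x]] by metis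
qed

lemma xends_nbrs_ge:
  assumes "v \<in> xends X" "x \<notin> X"
  shows "1 \<le> card (nbrs v \<inter> insert x X)" "card (nbrs v \<inter> insert x X) \<le> card (xends X)"
  using assms xpath_card_ge xpath_card_le by (auto simp: xends_def)

section \<open>Rerouting a Hamiltonian path\<close>

lemma ham_turn:
  assumes "ham (us @ x # zs @ u # bs)" "us \<noteq> []" "zs \<noteq> []" "adj (hd us) u"
  shows "ham (rev zs @ x # rev us @ u # bs)"
  using assms by (auto simp: ham_def is_path_simps adj_commute)

text \<open>The initial part up to \<open>v\<close> is cut off and walked backwards between
  \<open>zs\<close> and \<open>u\<close>, so the segment in front of \<open>x\<close> shrinks to
  \<open>us'\<close>.\<close>

lemma ham_shift:
  assumes "ham (us @ v # us' @ x # zs @ u # bs)" "zs \<noteq> []" "adj (hd (us @ [v])) u" "adj (last zs) v"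
  shows "ham (us' @ x # zs @ v # rev us @ u # bs)"
  using assms by (cases "us = []"; cases "us' = []") (auto simp: ham_def is_path_simps adj_commute)

text \<open>Only \<open>u0\<close> leaves the segment in front of \<open>x\<close>: the stretch
  \<open>u # ds\<close> is reversed, and \<open>u0\<close> then links \<open>u\<close> to
  \<open>u'\<close>.\<close>

lemma ham_insert:
  assumes "ham (u0 # us @ x # zs @ u # ds @ u' # bs)" "zs \<noteq> []" "adj u0 u" "adj u0 u'"
    "adj (last zs) (last (u # ds))"
  shows "ham (us @ x # zs @ rev (u # ds) @ u0 # u' # bs)"
  using assms by (cases "us = []"; cases "ds = []") (auto simp: ham_def is_path_simps adj_commute)

text \<open>The part \<open>pre\<close> behind \<open>x\<close> is fixed, and \<open>us\<close> is
  minimal only among paths continuing \<open>x\<close> by \<open>pre\<close>. This covers both later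
  uses: \<open>pre = []\<close> for the shortest segment \<open>X\<close>, and
  \<open>pre = xi\<close> for the second segment \<open>L\<close>.\<close>

context
  fixes us pre ps
  assumes P: "ham (us @ x # pre @ ps)" and us: "us \<noteq> []" and ps: "ps \<noteq> []"
    and not_pre: "\<And>v. v \<in> set pre \<Longrightarrow> \<not> adj (hd us) v"
    and not_hd: "pre = [] \<Longrightarrow> \<not> adj (hd us) (hd ps)"
    and x_start: "\<And>xs. ham xs \<Longrightarrow> hd xs \<noteq> x"
    and min: "\<And>vs qs. ham (vs @ x # pre @ qs) \<Longrightarrow> \<not> set vs \<subset> set us"
begin

lemma pre_nbrs_start:
  assumes "p \<in> pre_nbrs (hd us) pre ps"
  shows "\<exists>xs. ham xs \<and> hd xs = p"
proof -
  obtain cs u bs where *: "ps = cs @ u # bs" "adj (hd us) u" "pre @ cs \<noteq> []" "p = last (pre @ cs)"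
    using assms by (auto simp: pre_nbrs_def)
  have "ham (rev (pre @ cs) @ x # rev us @ u # bs)"
    using P us * by (intro ham_turn) auto
  moreover have "hd (rev (pre @ cs) @ x # rev us @ u # bs) = p"
    using * hd_rev[of "pre @ cs"] by (simp del: rev_append add: hd_append2)
  ultimately show ?thesis by blast
qed

lemma pre_nbrs_subset: "pre_nbrs (hd us) pre ps \<subseteq> set (pre @ ps)"
proof
  fix p assume "p \<in> pre_nbrs (hd us) pre ps"
  then obtain cs u bs where "ps = cs @ u # bs" "pre @ cs \<noteq> []" "p = last (pre @ cs)"
    by (auto simp: pre_nbrs_def)
  then show "p \<in> set (pre @ ps)" using last_in_set[of "pre @ cs"] by auto
qed

text \<open>Taking predecessors is injective. By \<open>not_pre\<close> the neighbours in question
  lie in \<open>ps\<close>, and \<open>not_hd\<close> ensures that \<open>x\<close> is not the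
  predecessor of any of them.\<close>

lemma card_pre_nbrs_ge: "card (nbrs (hd us) - insert x (set us)) \<le> card (pre_nbrs (hd us) pre ps)"
proof (rule card_le_if_inj_on_rel[where r = "\<lambda>u p. (p, u) \<in> consec (pre @ ps)"])
  show "finite (pre_nbrs (hd us) pre ps)" using pre_nbrs_subset finite_subset by blast
next
  fix u assume u: "u \<in> nbrs (hd us) - insert x (set us)"
  then have a: "adj (hd us) u" by (simp add: nbrs_def)
  then have "u \<in> set ps"
    using u P not_pre adj_A adj_commute by (fastforce simp: ham_def)
  then obtain cs bs where c: "ps = cs @ u # bs" by (meson split_list)
  have ne: "pre @ cs \<noteq> []" using a c not_hd by auto
  then have "last (pre @ cs) \<in> pre_nbrs (hd us) pre ps"
    unfolding pre_nbrs_def using a c by blast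
  moreover have "pre @ ps = butlast (pre @ cs) @ last (pre @ cs) # u # bs"
    using c ne by (metis append.assoc append_Cons append_Nil append_butlast_last_id)
  then have "(last (pre @ cs), u) \<in> consec (pre @ ps)"
    unfolding consec_iff by blast
  ultimately show "\<exists>p. p \<in> pre_nbrs (hd us) pre ps \<and> (p, u) \<in> consec (pre @ ps)" by blast
next
  fix u u' p
  assume "(p, u) \<in> consec (pre @ ps)" "(p, u') \<in> consec (pre @ ps)"
  moreover have "distinct (pre @ ps)" using P by (auto simp: ham_def is_path_def)
  ultimately show "u = u'" using consec_unique(1) by metis
qed

text \<open>Such an edge would permit \<open>ham_shift\<close>, leaving a smaller segment in front
  of \<open>x\<close> with \<open>pre\<close> still behind it.\<close>

lemma pre_nbrs_not_adj_prefix: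
  assumes "p \<in> pre_nbrs (hd us) pre ps" "v \<in> set us"
  shows "\<not> adj p v"
proof
  assume pv: "adj p v"
  obtain cs u bs where *: "ps = cs @ u # bs" "adj (hd us) u" "pre @ cs \<noteq> []" "p = last (pre @ cs)"
    using assms by (auto simp: pre_nbrs_def)
  obtain us1 us2 where v: "us = us1 @ v # us2" using assms(2) by (meson split_list)
  have "ham (us2 @ x # pre @ (cs @ rev (us1 @ [v]) @ u # bs))"
    using ham_shift[of us1 v us2 "pre @ cs" u bs] P us * pv v by (cases us1) auto
  moreover have "set us2 \<subset> set us" using v P by (auto simp: ham_def is_path_simps)
  ultimately show False using min by blast
qed

text \<open>An edge between two such predecessors would permit \<open>ham_insert\<close>, which
  removes the first vertex of \<open>us\<close> from the segment, against minimality.\<close>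

lemma pre_nbrs_indep:
  assumes "p \<in> pre_nbrs (hd us) pre ps" "q \<in> pre_nbrs (hd us) pre ps"
  shows "\<not> adj p q"
proof
  assume pq: "adj p q"
  obtain cs u bs where 1: "ps = cs @ u # bs" "adj (hd us) u" "pre @ cs \<noteq> []" "p = last (pre @ cs)"
    using assms(1) by (auto simp: pre_nbrs_def)
  obtain cs' u' bs' where 2: "ps = cs' @ u' # bs'" "adj (hd us) u'" "pre @ cs' \<noteq> []" "q = last (pre @ cs')"
    using assms(2) by (auto simp: pre_nbrs_def)
  have aux: False if 1: "ps = cs @ u # ds @ u' # bs'" "adj (hd us) u" "pre @ cs \<noteq> []"
    and 2: "adj (hd us) u'" and pq: "adj (last (pre @ cs)) (last (u # ds))" for cs u ds u' bs'
  proof -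
    obtain u0 us' where u0: "us = u0 # us'" using us by (cases us) auto
    have "ham (us' @ x # pre @ (cs @ rev (u # ds) @ u0 # u' # bs'))"
      using ham_insert[of u0 us' "pre @ cs" u ds u' bs'] P 1 2 pq u0 by simp
    moreover have "set us' \<subset> set us" using u0 P by (auto simp: ham_def is_path_simps)
    ultimately show False using min by blast
  qed
  consider "cs = cs'" | ds where "cs' = cs @ u # ds" | ds where "cs = cs' @ u' # ds"
  proof -
    obtain ws where "cs = cs' @ ws \<and> ws @ u # bs = u' # bs' \<or> cs @ ws = cs' \<and> u # bs = ws @ u' # bs'"
      using 1(1) 2(1) append_eq_append_conv2[of cs "u # bs" cs' "u' # bs'"] by metis
    then show thesis using that by (cases ws) auto
  qed
  then show False
  proof cases
    case 1
    then show ?thesis using \<open>p = _\<close> \<open>q = _\<close> pq not_adj_self by simp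
  next
    case (2 ds)
    then show ?thesis using aux[of cs u ds u' bs'] 1 \<open>ps = cs' @ u' # bs'\<close> \<open>adj (hd us) u'\<close> \<open>q = _\<close> pq by auto
  next
    case (3 ds)
    then show ?thesis using aux[of cs' u' ds u bs] 2 \<open>ps = cs @ u # bs\<close> \<open>adj (hd us) u\<close> \<open>p = _\<close> pq adj_commute by auto
  qed
qed

text \<open>The three families of \<open>degree_sum_ge\<close> become the predecessors, the starts
  of the segment and the starts of a second segment \<open>Y\<close>. The vertex \<open>x\<close>
  joins both enclosing sets, since it follows \<open>us\<close> on the path and counts towards inner
  degrees.\<close>

lemma degree_sum_ge_cell:
  assumes rich: "\<And>xs. ham xs \<Longrightarrow> d \<le> card (nbrs (hd xs))"
    and k: "k = card (nbrs (hd us) \<inter> insert x (set us))"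
    and k1: "\<And>v. v \<in> xends (set us) \<Longrightarrow> k \<le> card (nbrs v \<inter> insert x (set us))"
    and k2: "\<And>v. v \<in> xends Y \<Longrightarrow> k \<le> card (nbrs v \<inter> insert x Y)"
    and Y: "xends Y \<noteq> {}" "x \<notin> Y" "Y \<inter> set us = {}" "Y \<subseteq> A"
    and richY: "\<And>v. v \<in> xends Y \<Longrightarrow> d \<le> card (nbrs v)"
    and cross: "\<And>u v. u \<in> xends (set us) \<Longrightarrow> v \<in> xends Y \<Longrightarrow> \<not> adj u v"
    and w: "pre_nbrs (hd us) pre ps \<inter> insert x Y \<subseteq> {w}"
    and alt: "(\<forall>v\<in>xends Y. k < card (nbrs v \<inter> insert x Y)) \<or>
      (\<forall>v\<in>xends Y - {w}. path_nbrs (us @ x # pre @ ps) v \<subseteq> insert x Y)"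
  shows "2 * int (card A) + 2 * int d * (int d - 2) \<le> (\<Sum>u\<in>A. int (card (nbrs u))) + 1"
proof -
  let ?P = "us @ x # pre @ ps" and ?W = "pre_nbrs (hd us) pre ps"
  have dP: "distinct ?P" and pP: "is_path ?P" and sP: "set ?P = A"
    using P by (auto simp: ham_def is_path_def)
  have xus: "x \<notin> set us" and disj: "?W \<inter> set us = {}"
    using dP pre_nbrs_subset by auto
  have uX: "xpath (set us) us" using ham_xpath[OF P us] .
  have hdE: "hd us \<in> xends (set us)" using uX by (force simp: xends_def)
  show ?thesis
  proof (rule degree_sum_ge[where pn = "path_nbrs ?P" and W = ?W and ?E1.0 = "xends (set us)" and ?E2.0 = "xends Y"
      and ?Z1.0 = "insert x (set us)" and ?Z2.0 = "insert x Y" and s = "hd us" and k = k and w = w])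
    show "finite A" by (rule finite_A)
    show "nbrs u \<subseteq> A" for u by (rule nbrs_A)
    show "u \<in> nbrs v" if "v \<in> nbrs u" for u v using that adj_commute by (simp add: nbrs_def)
    show "path_nbrs ?P u \<subseteq> nbrs u" for u by (rule path_nbrs_adj[OF pP])
    show "u \<in> path_nbrs ?P v" if "v \<in> path_nbrs ?P u" for u v using that by (rule path_nbrs_sym)
    show "card (path_nbrs ?P u) \<le> 2" for u by (rule card_path_nbrs_le[OF dP])
    show "2 * int (card A) - 2 \<le> (\<Sum>u\<in>A. int (card (path_nbrs ?P u)))"
      using sum_card_path_nbrs[OF dP] by (simp only: sP) simp
    show "?W \<subseteq> A" using pre_nbrs_subset sP by auto
    show "xends (set us) \<subseteq> A" using xends_subset sP by fastforce
    show "xends Y \<subseteq> A" using xends_subset Y(4) by fastforce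
    show "xends (set us) \<subseteq> insert x (set us)" "xends Y \<subseteq> insert x Y" using xends_subset by fast+
    show "xends (set us) \<inter> xends Y = {}" using xends_subset Y(3) by blast
    show "?W \<inter> xends (set us) = {}" using xends_subset disj by blast
    show "hd us \<in> xends (set us)" by (rule hdE)
    show "card (path_nbrs ?P (hd us)) \<le> 1"
      using card_path_nbrs_hd[of "hd us" "tl us @ x # pre @ ps"] dP us by (cases us) auto
    show "card (nbrs (hd us) \<inter> insert x (set us)) = k" by (simp add: k)
    show "path_nbrs ?P v \<subseteq> insert x (set us)" if "v \<in> xends (set us)" for v
    proof -
      have "v \<in> set us" using that xends_subset by blast
      then obtain us1 us2 where v: "us = us1 @ v # us2" by (meson split_list)
      have "path_nbrs (us1 @ v # us2 @ x # pre @ ps) v \<subseteq> insert x (set us)"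
        using path_nbrs_subset[of us1 v "us2 @ x # pre @ ps"] dP v
        by (cases "us1 = []"; cases us2) (auto simp del: distinct_append)
      then show ?thesis using v by simp
    qed
    show "k \<le> card (nbrs v \<inter> insert x (set us)) \<and> card (nbrs v \<inter> insert x (set us)) \<le> card (xends (set us))"
      if "v \<in> xends (set us)" for v using that k1 xends_nbrs_ge(2)[OF that xus] by blast
    show "k \<le> card (nbrs v \<inter> insert x Y) \<and> card (nbrs v \<inter> insert x Y) \<le> card (xends Y)"
      if "v \<in> xends Y" for v using that k2 xends_nbrs_ge(2)[OF that Y(2)] by blast
    show "xends Y \<noteq> {}" by (rule Y)
    \<comment> \<open>The start has \<open>k\<close> neighbours in the segment and \<open>x\<close>,
      hence at least \<open>d - k\<close> others, each with its own predecessor.\<close>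
    have "card (nbrs (hd us)) = k + card (nbrs (hd us) - insert x (set us))"
      unfolding k using nbrs_A by (simp add: card_Int_Diff)
    then show "d \<le> card ?W + k" using rich[OF P] card_pre_nbrs_ge us by simp
    show "v \<notin> nbrs u" if "u \<in> ?W" "v \<in> ?W" for u v using pre_nbrs_indep that by (auto simp: nbrs_def)
    show "v \<notin> nbrs u" if "u \<in> ?W" "v \<in> xends (set us)" for u v
      using pre_nbrs_not_adj_prefix that xends_subset by (fastforce simp: nbrs_def)
    show "v \<notin> nbrs u" if "u \<in> xends (set us)" "v \<in> xends Y" for u v
      using cross that by (auto simp: nbrs_def)
    show "?W \<inter> insert x Y \<subseteq> {w}" by (rule w)
    show "d \<le> card (nbrs v)" if v: "v \<in> ?W \<union> xends (set us) \<union> xends Y" for v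
    proof -
      consider "v \<in> ?W" | vs where "xpath (set us) vs" "v = hd vs" | "v \<in> xends Y"
        using v by (auto simp: xends_def)
      then show ?thesis
      proof cases
        case 1
        then show ?thesis using pre_nbrs_start rich by blast
      next
        case (2 vs)
        then have "vs \<noteq> []" by (simp add: xpath_def)
        then show ?thesis using rich[OF ham_swap[OF P us 2(1)]] 2(2) by simp
      qed (rule richY)
    qed
    show "(\<forall>v\<in>xends Y. k < card (nbrs v \<inter> insert x Y)) \<or> (\<forall>v\<in>xends Y - {w}. path_nbrs ?P v \<subseteq> insert x Y)"
      by (rule alt)
    show "1 \<le> k" using xends_nbrs_ge(1)[OF hdE xus] k by simp
    show "2 \<le> d" by (rule two_le_d)
  qed
qed

end

text \<open>Makes the extremal choices of the two segments. The hypothesis \<open>leave\<close> is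
  what minimality of the closed pair provides.\<close>

lemma degree_sum_ge_ham:
  assumes ex: "ham xs0"
    and rich: "\<And>xs. ham xs \<Longrightarrow> d \<le> card (nbrs (hd xs))"
    and x_start: "\<And>xs. ham xs \<Longrightarrow> hd xs \<noteq> x"
    and leave: "\<And>us ps. ham (us @ x # ps) \<Longrightarrow> us \<noteq> [] \<Longrightarrow> ps \<noteq> [] \<Longrightarrow> \<exists>v\<in>xends (set us). \<exists>u\<in>set ps. adj v u"
  shows "2 * int (card A) + 2 * int d * (int d - 2) \<le> (\<Sum>u\<in>A. int (card (nbrs u))) + 1"
proof -
  have "\<exists>us ps. ham (us @ x # ps)"
    using ex x_A by (metis ham_def split_list)
  then obtain us where us: "\<exists>ps. ham (us @ x # ps)" and min: "\<And>vs qs. ham (vs @ x # qs) \<Longrightarrow> card (set us) \<le> card (set vs)"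
    using ex_has_least_nat[of "\<lambda>us. \<exists>ps. ham (us @ x # ps)" _ "\<lambda>us. card (set us)"] by blast
  then obtain ps where P: "ham (us @ x # ps)" by blast
  have us_ne: "us \<noteq> []" using x_start[OF P] by auto
  have ps_ne: "ps \<noteq> []" using P x_y by (auto simp: ham_def)
  define X where "X = set us"
  have xX: "x \<notin> X" and psX: "X \<inter> set ps = {}" and XA: "X \<subseteq> A"
    using P by (auto simp: ham_def is_path_simps X_def)
  have swap: "ham (vs @ x # ps)" if "xpath X vs" for vs
    using ham_swap[OF P us_ne] that by (simp add: X_def)
  have minX: "\<not> set vs \<subset> X" if "ham (vs @ x # qs)" for vs qs
    using min[OF that] psubset_card_mono[of X "set vs"] by (auto simp: X_def)
  \<comment> \<open>Otherwise the segment could be reversed behind \<open>x\<close>, giving a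
    Hamiltonian path that starts at \<open>x\<close>.\<close>
  have hd_ps: "\<not> adj v (hd ps)" if v: "v \<in> xends X" for v
  proof
    assume a: "adj v (hd ps)"
    obtain vs where vs: "xpath X vs" "v = hd vs" using v by (auto simp: xends_def)
    have "ham ([] @ x # rev vs @ ps)"
      using swap[OF vs(1)] vs a ps_ne by (auto simp: ham_def xpath_def is_path_simps adj_commute)
    then show False using x_start by fastforce
  qed
  have "\<exists>u\<in>set ps. \<exists>v\<in>xends X. adj v u" using leave[OF P us_ne ps_ne] by (auto simp: X_def)
  \<comment> \<open>With \<open>u\<close> chosen first, no vertex of \<open>cs\<close> is adjacent
    to a start in \<open>X\<close>; this later confines the predecessors meeting \<open>L\<close> to
    \<open>last cs\<close>.\<close>
  then obtain cs u bs where ps: "ps = cs @ u # bs" and u: "\<exists>v\<in>xends X. adj v u"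
    and cs: "\<And>c. c \<in> set cs \<Longrightarrow> \<not> (\<exists>v\<in>xends X. adj v c)"
    by (rule split_list_first_propE) blast
  obtain es where es: "xpath X es" "adj (hd es) u" using u by (auto simp: xends_def)
  have cs_ne: "cs \<noteq> []" using u hd_ps ps by auto
  define xi where "xi = rev es"
  have xi: "set xi = X" "xi \<noteq> []" using es by (auto simp: xi_def xpath_def)
  let ?Q = "\<lambda>ls. set ls \<subseteq> set cs \<and> (\<exists>tau. ham (ls @ x # xi @ tau))"
  \<comment> \<open>Turning along the edge from \<open>hd es\<close> to \<open>u\<close> brings
    \<open>cs\<close> in front of \<open>x\<close> and puts \<open>X\<close>, in the order
    \<open>xi\<close>, right behind it.\<close>
  have "ham (rev cs @ x # xi @ u # bs)"
    using swap[OF es(1)] es cs_ne unfolding ps xi_def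
    by (auto simp: ham_def xpath_def is_path_simps adj_commute)
  then have "?Q (rev cs)" by auto
  then obtain ls where ls: "?Q ls" and minls: "\<And>vs. ?Q vs \<Longrightarrow> card (set ls) \<le> card (set vs)"
    using ex_has_least_nat[of ?Q _ "\<lambda>us. card (set us)"] by blast
  then obtain tau where R: "ham (ls @ x # xi @ tau)" and ls_cs: "set ls \<subseteq> set cs" by blast
  have ls_ne: "ls \<noteq> []" using x_start[OF R] by auto
  define L where "L = set ls"
  have LX: "L \<inter> X = {}" and xL: "x \<notin> L" and LA: "L \<subseteq> A"
    using R xi by (auto simp: ham_def is_path_simps L_def)
  have swapL: "ham (vs @ x # xi @ tau)" if "xpath L vs" for vs
    using ham_swap[OF R ls_ne] that by (simp add: L_def)
  \<comment> \<open>Turning along such an edge would leave in front of \<open>x\<close> only the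
    part of \<open>xi\<close> before \<open>c\<close>, a proper subset of \<open>X\<close>.\<close>
  have cross: "\<not> adj v c" if v: "v \<in> xends L" and c: "c \<in> X" for v c
  proof
    assume a: "adj v c"
    obtain vs where vs: "xpath L vs" "v = hd vs" using v by (auto simp: xends_def)
    obtain xi1 xi2 where x12: "xi = xi1 @ c # xi2" using c xi by (metis split_list)
    have "ham (rev xi1 @ x # rev vs @ c # xi2 @ tau)"
      using swapL[OF vs(1)] vs a unfolding x12
      by (cases "xi1 = []") (auto simp: ham_def xpath_def is_path_simps adj_commute)
    moreover have "set (rev xi1) \<subset> X"
      using R x12 xi(1) by (auto simp: ham_def is_path_simps)
    ultimately show False using minX by blast
  qed
  define iX where "iX v = card (nbrs v \<inter> insert x X)" for v
  define iL where "iL v = card (nbrs v \<inter> insert x L)" for v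
  have "xpath X us" "xpath L ls"
    using ham_xpath[OF P us_ne] ham_xpath[OF R ls_ne] by (simp_all add: X_def L_def)
  then obtain us0 vs0 where us0: "xpath X us0" "\<And>vs. xpath X vs \<Longrightarrow> iX (hd us0) \<le> iX (hd vs)"
    and vs0: "xpath L vs0" "\<And>vs. xpath L vs \<Longrightarrow> iL (hd vs0) \<le> iL (hd vs)"
    using ex_has_least_nat[of "xpath X" us "\<lambda>vs. iX (hd vs)"] ex_has_least_nat[of "xpath L" ls "\<lambda>vs. iL (hd vs)"]
    by blast
  have sX: "set us0 = X" "us0 \<noteq> []" and sL: "set vs0 = L" "vs0 \<noteq> []"
    using us0(1) vs0(1) by (auto simp: xpath_def)
  have hX: "hd us0 \<in> xends X" and hL: "hd vs0 \<in> xends L"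
    using us0 vs0 by (auto simp: xends_def)
  have iX: "iX (hd us0) \<le> iX v" if "v \<in> xends X" for v using that us0(2) by (auto simp: xends_def)
  have iL: "iL (hd vs0) \<le> iL v" if "v \<in> xends L" for v using that vs0(2) by (auto simp: xends_def)
  have richX: "d \<le> card (nbrs v)" if v: "v \<in> xends X" for v
  proof -
    obtain vs where "xpath X vs" "v = hd vs" "vs \<noteq> []" using v by (auto simp: xends_def xpath_def)
    then show ?thesis using rich[OF swap[of vs]] by simp
  qed
  have richL: "d \<le> card (nbrs v)" if v: "v \<in> xends L" for v
  proof -
    obtain vs where "xpath L vs" "v = hd vs" "vs \<noteq> []" using v by (auto simp: xends_def xpath_def)
    then show ?thesis using rich[OF swapL[of vs]] by simp
  qed
  show ?thesis
  \<comment> \<open>The segment with the smaller minimal inner degree supplies \<open>E1\<close>, so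
    that \<open>k\<close> bounds the inner degrees of the other segment as well. Strict inequality
    yields the first alternative of \<open>alt\<close>; in the other case the second one
    holds.\<close>
  proof (cases "iX (hd us0) < iL (hd vs0)")
    case True
    show ?thesis
    proof (rule degree_sum_ge_cell[where us = us0 and pre = "[]" and ps = ps and Y = L and k = "iX (hd us0)"
        and w = "last cs"])
      show "ham (us0 @ x # [] @ ps)" using swap us0 by simp
      show "\<not> adj (hd us0) (hd ps)" using hd_ps hX .
      show "\<not> set vs \<subset> set us0" if "ham (vs @ x # [] @ qs)" for vs qs using minX that sX by auto
      show "iX (hd us0) = card (nbrs (hd us0) \<inter> insert x (set us0))" by (simp add: iX_def sX)
      show "iX (hd us0) \<le> card (nbrs v \<inter> insert x (set us0))" if "v \<in> xends (set us0)" for v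
        using iX that by (simp add: iX_def sX)
      show "iX (hd us0) \<le> card (nbrs v \<inter> insert x L)" if "v \<in> xends L" for v
        using iL[OF that] True by (simp add: iL_def)
      show "\<not> adj v v'" if "v \<in> xends (set us0)" "v' \<in> xends L" for v v'
        using cross[OF that(2)] that(1) xends_subset adj_commute sX by blast
      show "(\<forall>v\<in>xends L. iX (hd us0) < card (nbrs v \<inter> insert x L)) \<or>
          (\<forall>v\<in>xends L - {last cs}. path_nbrs (us0 @ x # [] @ ps) v \<subseteq> insert x L)"
        using iL True by (fastforce simp: iL_def)
      \<comment> \<open>Neighbours of \<open>hd us0\<close> avoid \<open>cs\<close>, so their
        predecessors in \<open>ps\<close> are \<open>last cs\<close> or come after it, while
        \<open>L\<close> lies within \<open>cs\<close>.\<close>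
      show "pre_nbrs (hd us0) [] ps \<inter> insert x L \<subseteq> {last cs}"
      proof
        fix p assume p: "p \<in> pre_nbrs (hd us0) [] ps \<inter> insert x L"
        then obtain cs' u' bs' where c: "ps = cs' @ u' # bs'" "adj (hd us0) u'" "cs' \<noteq> []" "p = last cs'"
          by (auto simp: pre_nbrs_def)
        have "u' \<notin> set cs" using cs hX c(2) by blast
        obtain ws where "cs' = cs @ ws \<and> ws @ u' # bs' = u # bs \<or> cs' @ ws = cs \<and> u' # bs' = ws @ u # bs"
          using c(1) ps append_eq_append_conv2[of cs' "u' # bs'" cs "u # bs"] by metis
        then have ws: "cs' = cs @ ws" "ws @ u' # bs' = u # bs"
          using \<open>u' \<notin> set cs\<close> by (cases ws; auto)+
        show "p \<in> {last cs}"
        proof (cases "ws = []")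
          case True
          then show ?thesis using ws c by simp
        next
          case False
          then have "p \<in> set (u # bs)" using ws c
            by (metis Un_iff last_appendR last_in_set set_append)
          moreover have "p \<in> insert x (set cs)" using p ls_cs by (auto simp: L_def)
          moreover have "distinct (x # ps)" using P by (simp add: ham_def is_path_def)
          ultimately show ?thesis using ps by auto
        qed
      qed
    qed (use rich richL x_start xL LX LA sX ps_ne hL in auto)
  next
    case False
    have tau_ne: "tau \<noteq> []"
    proof
      assume "tau = []"
      then have "y \<in> X" using R xi by (auto simp: ham_def)
      moreover have "y \<in> set ps" using P ps_ne by (auto simp: ham_def)
      ultimately show False using psX by blast
    qed
    show ?thesis
    proof (rule degree_sum_ge_cell[where us = vs0 and pre = xi and ps = tau and Y = X and k = "iL (hd vs0)"
        and w = "last xi"])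
      show "ham (vs0 @ x # xi @ tau)" using swapL vs0 by simp
      show "\<not> adj (hd vs0) v" if "v \<in> set xi" for v using cross[OF hL] that xi by simp
      show "\<not> set vs \<subset> set vs0" if "ham (vs @ x # xi @ qs)" for vs qs
      proof
        assume v: "set vs \<subset> set vs0"
        then have "?Q vs" using that sL ls_cs by (auto simp: L_def)
        then show False using minls[of vs] v sL psubset_card_mono[of "set ls" "set vs"] by (auto simp: L_def)
      qed
      show "iL (hd vs0) = card (nbrs (hd vs0) \<inter> insert x (set vs0))" by (simp add: iL_def sL)
      show "iL (hd vs0) \<le> card (nbrs v \<inter> insert x (set vs0))" if "v \<in> xends (set vs0)" for v
        using iL that by (simp add: iL_def sL)
      show "iL (hd vs0) \<le> card (nbrs v \<inter> insert x X)" if "v \<in> xends X" for v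
        using iX[OF that] False by (simp add: iX_def)
      show "\<not> adj v v'" if "v \<in> xends (set vs0)" "v' \<in> xends X" for v v'
        using cross that xends_subset sL by blast
      show "pre_nbrs (hd vs0) xi tau \<inter> insert x X \<subseteq> {last xi}"
      proof
        fix p assume p: "p \<in> pre_nbrs (hd vs0) xi tau \<inter> insert x X"
        then obtain cs' u' bs' where c: "tau = cs' @ u' # bs'" "p = last (xi @ cs')"
          by (auto simp: pre_nbrs_def)
        have "insert x X \<inter> set tau = {}" using R xi by (auto simp: ham_def is_path_simps)
        then show "p \<in> {last xi}" using c p by (cases "cs' = []") auto
      qed
      \<comment> \<open>Here \<open>X\<close> is traversed as the interval \<open>xi\<close> right
        behind \<open>x\<close>, so only \<open>last xi\<close> can have a path neighbour outside
        \<open>insert x X\<close>.\<close>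
      show "(\<forall>v\<in>xends X. iL (hd vs0) < card (nbrs v \<inter> insert x X)) \<or>
          (\<forall>v\<in>xends X - {last xi}. path_nbrs (vs0 @ x # xi @ tau) v \<subseteq> insert x X)"
      proof (intro disjI2 ballI)
        fix v assume v: "v \<in> xends X - {last xi}"
        then have "v \<in> set xi" using xends_subset xi by blast
        then obtain xi1 xi2 where x12: "xi = xi1 @ v # xi2" by (meson split_list)
        have "xi2 \<noteq> []" using v x12 by auto
        moreover have "distinct (vs0 @ x # xi @ tau)"
          using swapL[OF vs0(1)] by (simp only: ham_def is_path_def)
        ultimately show "path_nbrs (vs0 @ x # xi @ tau) v \<subseteq> insert x X"
          using path_nbrs_subset[of "vs0 @ x # xi1" v "xi2 @ tau"] x12 xi(1)
          by (cases "xi1 = []") (auto simp del: distinct_append)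
      qed
    qed (use rich richX x_start xX LX XA sL tau_ne hX xi in auto)
  qed
qed

end

subsection \<open>A minimal closed pair\<close>

context sym_adjacency
begin

definition hampath :: "'a set \<Rightarrow> 'a \<Rightarrow> 'a list \<Rightarrow> bool" where
  "hampath B y xs \<longleftrightarrow> is_path xs \<and> xs \<noteq> [] \<and> set xs = B \<and> last xs = y"

text \<open>The start must avoid \<open>z\<close> because only the degree of \<open>z\<close> may be
  below \<open>d\<close>. The bound on the size makes the start differ from
  \<open>y\<close>.\<close>

definition end_closed :: "'a \<Rightarrow> 'a set \<Rightarrow> 'a \<Rightarrow> bool" where
  "end_closed z B y \<longleftrightarrow> 2 \<le> card B \<and> (\<exists>xs. hampath B y xs) \<and>
     (\<forall>xs. hampath B y xs \<longrightarrow> hd xs \<noteq> z \<and> nbrs (hd xs) \<subseteq> B)"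

lemma is_path_length: "is_path xs \<Longrightarrow> length xs = card (set xs)"
  by (simp add: is_path_def distinct_card)

text \<open>The vertex set of a longest path ending at \<open>z\<close> works: each of its
  Hamiltonian paths ending at \<open>z\<close> is also longest, so its start has no neighbour
  outside.\<close>

lemma ex_end_closed:
  assumes V: "finite V" "\<And>u v. adj u v \<Longrightarrow> u \<in> V" and z: "z \<in> V" "nbrs z \<noteq> {}"
  shows "\<exists>A\<subseteq>V. end_closed z A z"
proof -
  let ?Q = "\<lambda>xs. is_path xs \<and> xs \<noteq> [] \<and> set xs \<subseteq> V \<and> last xs = z"
  have bound: "length xs < Suc (card V)" if "?Q xs" for xs
    using that card_mono[OF V(1)] by (simp add: is_path_length less_Suc_eq_le)
  obtain v where v: "adj v z" using z adj_commute by (auto simp: nbrs_def)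
  have vz: "?Q [v, z]"
    using v z V not_adj_self by (auto simp: is_path_simps)
  obtain P where P: "?Q P" and max: "\<And>xs. ?Q xs \<Longrightarrow> length xs \<le> length P"
    using ex_has_greatest_nat[of ?Q "[v, z]" length "Suc (card V)"] vz bound by blast
  have two: "2 \<le> card (set P)" using max[OF vz] P by (simp add: is_path_length)
  have "hd xs \<noteq> z \<and> nbrs (hd xs) \<subseteq> set P" if xs: "hampath (set P) z xs" for xs
  proof
    have len: "length xs = length P" using xs P by (simp add: hampath_def is_path_length)
    have "2 \<le> length xs" "is_path xs" "last xs = z" using xs two by (auto simp: hampath_def is_path_length)
    then show "hd xs \<noteq> z"
      by (cases xs) (auto simp: is_path_simps split: if_splits)
    show "nbrs (hd xs) \<subseteq> set P"
    proof
      fix u assume u: "u \<in> nbrs (hd xs)"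
      show "u \<in> set P"
      proof (rule ccontr)
        assume "u \<notin> set P"
        then have "?Q (u # xs)"
          using xs u P V adj_commute[of "hd xs" u] by (auto simp: hampath_def is_path_simps nbrs_def)
        then show False using max[of "u # xs"] len by simp
      qed
    qed
  qed
  then show ?thesis using P two by (intro exI[of _ "set P"]) (auto simp: end_closed_def hampath_def)
qed

text \<open>Choose a Hamiltonian path whose start has a neighbour \<open>v\<close> as far along as
  possible. Any reordering of the prefix that still ends at \<open>v\<close> extends by
  \<open>bs\<close> to a Hamiltonian path of \<open>A\<close>, so the prefix with \<open>v\<close>
  is again a closed pair, and by minimality it is all of \<open>A\<close>.\<close>

lemma minimal_end_closed_cycle:
  assumes A: "finite A" "end_closed z A y"
    and min: "\<And>B v. B \<subseteq> A \<Longrightarrow> end_closed z B v \<Longrightarrow> card A \<le> card B"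
    and nbrs_ne: "\<And>v. v \<in> A \<Longrightarrow> v \<noteq> z \<Longrightarrow> nbrs v \<noteq> {}"
  shows "\<exists>q. hampath A y q \<and> adj (hd q) y"
proof -
  let ?Q = "\<lambda>as. \<exists>v bs. hampath A y (as @ v # bs) \<and> as \<noteq> [] \<and> adj (hd as) v"
  have bound: "length as < Suc (card A)" if Q: "?Q as" for as
  proof -
    obtain v bs where "hampath A y (as @ v # bs)" using Q by blast
    then show ?thesis using is_path_length[of "as @ v # bs"] by (auto simp: hampath_def)
  qed
  obtain xs where xs: "hampath A y xs" using A by (auto simp: end_closed_def)
  then have hd: "hd xs \<in> A" "hd xs \<noteq> z" "nbrs (hd xs) \<subseteq> A"
    using A(2) by (auto simp: end_closed_def hampath_def)
  then obtain v where v: "adj (hd xs) v" "v \<in> A" using nbrs_ne by (force simp: nbrs_def)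
  then obtain as bs where s: "xs = as @ v # bs" using xs by (metis hampath_def split_list)
  then have "as \<noteq> []" using v not_adj_self by auto
  then have "?Q as" using xs s v by auto
  then obtain as where "?Q as" and max: "\<And>as'. ?Q as' \<Longrightarrow> length as' \<le> length as"
    using ex_has_greatest_nat[of ?Q as length "Suc (card A)"] bound by blast
  then obtain v bs where q: "hampath A y (as @ v # bs)" "as \<noteq> []" "adj (hd as) v" by blast
  let ?B = "set (as @ [v])"
  have len: "card ?B = Suc (length as)"
    using q(1) is_path_length[of "as @ [v]"] by (auto simp: hampath_def is_path_simps)
  have "end_closed z ?B v"
    unfolding end_closed_def
  proof (intro conjI allI impI)
    show "2 \<le> card ?B" using len q(2) by (cases as) auto
    show "\<exists>xs. hampath ?B v xs"
      using q(1) by (intro exI[of _ "as @ [v]"]) (auto simp: hampath_def is_path_simps)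
    fix r assume r: "hampath ?B v r"
    then have rb: "hampath A y (r @ bs)" "hd (r @ bs) = hd r"
      using q(1) by (auto simp: hampath_def is_path_simps split: if_splits)
    then show "hd r \<noteq> z" using A(2) by (auto simp: end_closed_def)
    have sub: "nbrs (hd r) \<subseteq> A" using A(2) rb unfolding end_closed_def by metis
    show "nbrs (hd r) \<subseteq> ?B"
    proof (rule ccontr)
      assume "\<not> nbrs (hd r) \<subseteq> ?B"
      then obtain w where w: "w \<in> nbrs (hd r)" "w \<notin> ?B" by blast
      then have "w \<in> set bs" using sub q(1) by (auto simp: hampath_def)
      then obtain b1 b2 where b: "bs = b1 @ w # b2" by (meson split_list)
      have "r \<noteq> []" using r by (simp add: hampath_def)
      \<comment> \<open>Since \<open>r\<close> includes \<open>v\<close>, it is already longer than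
        \<open>as\<close>, against the maximal choice of \<open>as\<close>.\<close>
      then have "?Q (r @ b1)" using rb(1) b w(1) by (auto simp: nbrs_def)
      then have "length r \<le> length as" using max by fastforce
      moreover have "length r = card ?B" using r by (simp add: hampath_def is_path_length)
      ultimately show False using len by simp
    qed
  qed
  moreover have BA: "?B \<subseteq> A" using q(1) by (auto simp: hampath_def)
  ultimately have "?B = A" using min A(1) by (meson card_seteq)
  then have "bs = []" using q(1) by (cases bs) (auto simp: hampath_def is_path_simps)
  then show ?thesis using q by (intro exI[of _ "as @ [v]"]) (auto simp: hampath_def)
qed

text \<open>\<open>conn\<close> expresses connectedness after deleting any one vertex. The degree
  sum counts each edge within the vertex set of the cycle twice; \<open>2 * card (set q)\<close>
  accounts for the edges of the cycle itself.\<close>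

lemma ex_cycle_degree_sum_ge:
  assumes V: "finite V" "\<And>u v. adj u v \<Longrightarrow> u \<in> V" and z: "z \<in> V" and d: "2 \<le> d" and n: "2 * d + 1 \<le> card V"
    and deg: "\<And>v. v \<in> V \<Longrightarrow> v \<noteq> z \<Longrightarrow> d \<le> card (nbrs v)"
    and conn: "\<And>y S. y \<in> V \<Longrightarrow> S \<subset> V - {y} \<Longrightarrow> S \<noteq> {} \<Longrightarrow> \<exists>u\<in>S. \<exists>v\<in>V - {y} - S. adj u v"
  shows "\<exists>q. is_path q \<and> set q \<subseteq> V \<and> 3 \<le> length q \<and> adj (last q) (hd q) \<and>
    2 * int (card (set q)) + 2 * int d * (int d - 2) \<le> (\<Sum>u\<in>set q. int (card (nbrs u \<inter> set q))) + 1"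
proof -
  have fin: "finite (nbrs v)" and nV: "nbrs v \<subseteq> V" for v
    using V adj_commute by (auto simp: nbrs_def intro: finite_subset[of _ V])
  have ne: "nbrs v \<noteq> {}" if "v \<in> V" for v
  proof -
    have "2 < card V" using d n by simp
    then have "\<not> V \<subseteq> {v}" using card_mono[of "{v}" V] by auto
    then obtain y where y: "y \<in> V" "y \<noteq> v" by blast
    have "\<not> V \<subseteq> {y, v}" using card_mono[of "{y, v}" V] \<open>2 < card V\<close> y(2) by auto
    then show ?thesis using conn[of y "{v}"] y that by (auto simp: nbrs_def)
  qed
  let ?Q = "\<lambda>(A, y). A \<subseteq> V \<and> end_closed z A y"
  obtain A0 where "?Q (A0, z)" using ex_end_closed[of V z] V z ne by auto
  then obtain Ay where "?Q Ay" and minQ: "\<And>By. ?Q By \<Longrightarrow> card (fst Ay) \<le> card (fst By)"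
    using ex_has_least_nat[of ?Q "(A0, z)" "\<lambda>By. card (fst By)"] by blast
  moreover obtain A y where Ay: "Ay = (A, y)" by (cases Ay)
  ultimately have AV: "A \<subseteq> V" and A: "end_closed z A y" by simp_all
  have min: "card A \<le> card B" if "B \<subseteq> V" "end_closed z B v" for B v
    using minQ[of "(B, v)"] that Ay by simp
  have finA: "finite A" using AV V(1) by (rule finite_subset)
  have closed: "hd xs \<noteq> z" "nbrs (hd xs) \<subseteq> A" "hd xs \<in> A" if "hampath A y xs" for xs
    using A that by (auto simp: end_closed_def hampath_def)
  obtain q where q: "hampath A y q" "adj (hd q) y"
    using minimal_end_closed_cycle[OF finA A] min AV ne by blast
  have qA: "set q = A" "is_path q" "q \<noteq> []" "last q = y" using q(1) by (auto simp: hampath_def)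
  have hdq: "hd q \<in> A" using qA hd_in_set by blast
  have "d \<le> card (nbrs (hd q))" using deg closed[OF q(1)] AV by blast
  also have "\<dots> \<le> card (A - {hd q})"
    using closed[OF q(1)] finA not_adj_self by (intro card_mono) (auto simp: nbrs_def)
  also have "\<dots> = card A - 1" using hdq finA by simp
  finally have len: "3 \<le> length q" using d qA by (simp add: is_path_length)
  have "2 * int (card A) + 2 * int d * (int d - 2) \<le> (\<Sum>u\<in>A. int (card (nbrs u \<inter> A))) + 1"
  proof (cases "A = V")
    case True
    \<comment> \<open>With degree at least 1 at \<open>z\<close> and \<open>d\<close> elsewhere, the
      claim reduces to \<open>(2 * d + 1) * (d - 2) \<le> card V * (d - 2)\<close>, which is the
      bound on the order.\<close>
    have "(\<Sum>u\<in>V. if u = z then 1 else int d) \<le> (\<Sum>u\<in>V. int (card (nbrs u \<inter> A)))"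
    proof (rule sum_mono)
      fix u assume u: "u \<in> V"
      have "nbrs u \<inter> A = nbrs u" using nV True by blast
      moreover have "1 \<le> card (nbrs u)" using ne[OF u] fin by (simp add: Suc_leI card_gt_0_iff)
      ultimately show "(if u = z then 1 else int d) \<le> int (card (nbrs u \<inter> A))" using deg[OF u] by auto
    qed
    moreover have "(\<Sum>u\<in>V. if u = z then 1 else int d) = 1 + (int (card V) - 1) * int d"
    proof -
      have "(\<Sum>u\<in>V. if u = z then 1 else int d) = 1 + (\<Sum>u\<in>V - {z}. if u = z then 1 else int d)"
        using V z by (simp add: sum.remove)
      also have "(\<Sum>u\<in>V - {z}. if u = z then 1 else int d) = (\<Sum>u\<in>V - {z}. int d)"
        by (rule sum.cong) auto
      finally show ?thesis using V z n by (simp add: of_nat_diff)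
    qed
    moreover have "(2 * int d + 1) * (int d - 2) \<le> int (card V) * (int d - 2)"
      using n d by (intro mult_right_mono) auto
    ultimately show ?thesis using True by (simp add: algebra_simps)
  next
    case False
    have yA: "y \<in> A" using qA last_in_set by blast
    have "A - {y} \<noteq> {}"
      using A yA card_mono[of "{y}" A] by (fastforce simp: end_closed_def)
    \<comment> \<open>An edge leaves \<open>A - {y}\<close> even after deleting \<open>y\<close>.
      Its end \<open>x\<close> has a neighbour outside \<open>A\<close>, so closedness forbids
      \<open>x\<close> as a start.\<close>
    then obtain x w where x: "x \<in> A" "x \<noteq> y" and w: "w \<notin> A" "adj x w"
      using conn[of y "A - {y}"] AV False yA by blast
    define adjA where "adjA u v \<longleftrightarrow> adj u v \<and> u \<in> A \<and> v \<in> A" for u v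
    interpret sub: ham_core adjA A x y d
      using finA x d adj_commute not_adj_self by unfold_locales (auto simp: adjA_def)
    have path: "sub.is_path xs \<longleftrightarrow> is_path xs" if "set xs \<subseteq> A" for xs
    proof -
      have "successively adjA xs = successively adj xs"
        by (rule successively_cong) (use that in \<open>auto simp: adjA_def\<close>)
      then show ?thesis by (simp add: sub.is_path_def is_path_def)
    qed
    have ham: "hampath A y xs" if "sub.ham xs" for xs
      using that path x by (auto simp: sub.ham_def hampath_def)
    have nb: "sub.nbrs v = nbrs v \<inter> A" if "v \<in> A" for v
      using that by (auto simp: sub.nbrs_def nbrs_def adjA_def)
    have nx: "hd xs \<noteq> x" if "sub.ham xs" for xs
      using closed(2)[OF ham[OF that]] w by (auto simp: nbrs_def)
    have "2 * int (card A) + 2 * int d * (int d - 2) \<le> (\<Sum>u\<in>A. int (card (sub.nbrs u))) + 1"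
    proof (rule sub.degree_sum_ge_ham)
      show "sub.ham q" using qA path by (auto simp: sub.ham_def)
      show "d \<le> card (sub.nbrs (hd xs))" if "sub.ham xs" for xs
      proof -
        have "sub.nbrs (hd xs) = nbrs (hd xs)" using closed[OF ham[OF that]] nb by blast
        then show ?thesis using closed[OF ham[OF that]] deg AV by auto
      qed
      show "hd xs \<noteq> x" if "sub.ham xs" for xs using nx that .
      show "\<exists>v\<in>sub.xends (set us). \<exists>u\<in>set ps. adjA v u"
        if P: "sub.ham (us @ x # ps)" and us: "us \<noteq> []" and ps: "ps \<noteq> []" for us ps
      proof (rule ccontr)
        assume no: "\<not> (\<exists>v\<in>sub.xends (set us). \<exists>u\<in>set ps. adjA v u)"
        let ?B = "insert x (set us)"
        have PA: "hampath A y (us @ x # ps)" using ham[OF P] .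
        have BA: "?B \<subset> A" using PA ps by (cases ps) (auto simp: hampath_def is_path_simps)
        have xus: "x \<notin> set us" using PA by (auto simp: hampath_def is_path_simps)
        \<comment> \<open>A Hamiltonian path of \<open>?B\<close> ending at \<open>x\<close> is a
          segment followed by \<open>x\<close>. Prolonged by \<open>ps\<close> it shows that the
          neighbours of its start lie in \<open>A\<close>, and by \<open>no\<close> none of them
          lies in \<open>ps\<close>.\<close>
        have "end_closed z ?B x"
          unfolding end_closed_def
        proof (intro conjI allI impI)
          have "0 < card (set us)" using us by (simp add: card_gt_0_iff)
          then show "2 \<le> card ?B" using xus by simp
          show "\<exists>xs. hampath ?B x xs"
            using PA by (intro exI[of _ "us @ [x]"]) (auto simp: hampath_def is_path_simps)
          fix r assume r: "hampath ?B x r"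
          then obtain vs where rv: "r = vs @ [x]" by (metis append_butlast_last_id hampath_def)
          have "insert x (set vs) = insert x (set us)" "x \<notin> set vs"
            using r rv by (auto simp: hampath_def is_path_simps)
          then have svs: "set vs = set us" using xus by (simp add: insert_ident)
          then have vs: "vs \<noteq> []" using us by auto
          have pvs: "is_path vs" "adj (last vs) x"
            using r rv vs by (auto simp: hampath_def is_path_simps)
          have "last vs \<in> A" using vs svs BA last_in_set[of vs] by auto
          then have xp: "sub.xpath (set us) vs"
            using pvs svs vs path[of vs] BA x by (auto simp: sub.xpath_def adjA_def)
          then have hx: "hd vs \<in> sub.xends (set us)" by (auto simp: sub.xends_def)
          have h: "hampath A y (vs @ x # ps)" using ham[OF sub.ham_swap[OF P us xp]] .
          then show "hd r \<noteq> z" using closed(1)[OF h] rv vs by simp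
          have "nbrs (hd vs) \<subseteq> A" "hd vs \<in> A" using closed[OF h] vs by simp_all
          moreover have "A \<subseteq> ?B \<union> set ps" using PA by (auto simp: hampath_def)
          ultimately show "nbrs (hd r) \<subseteq> ?B"
            using no hx rv vs by (fastforce simp: nbrs_def adjA_def)
        qed
        then have "card A \<le> card ?B" using min BA AV by blast
        then show False using psubset_card_mono[OF finA BA] by simp
      qed
    qed
    then show ?thesis using nb by simp
  qed
  then show ?thesis using qA AV len q(2) adj_commute by (intro exI[of _ q]) auto
qed

end

subsection \<open>Cycles and chords of a graph\<close>

context wf_digraph
begin

definition arc_between :: "'a \<times> 'a \<Rightarrow> 'b" where
  "arc_between uv = (SOME e. e \<in> arcs G \<and> arc_to_ends G e = uv)"

lemma arc_between:
  assumes "u \<rightarrow>\<^bsub>G\<^esub> v"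
  shows "arc_between (u, v) \<in> arcs G" "tail G (arc_between (u, v)) = u" "head G (arc_between (u, v)) = v"
proof -
  have "\<exists>e. e \<in> arcs G \<and> arc_to_ends G e = (u, v)" using assms by (auto simp: arcs_ends_def)
  then have "arc_between (u, v) \<in> arcs G \<and> arc_to_ends G (arc_between (u, v)) = (u, v)"
    unfolding arc_between_def by (rule someI_ex)
  then show "arc_between (u, v) \<in> arcs G" "tail G (arc_between (u, v)) = u" "head G (arc_between (u, v)) = v"
    by (auto simp: arc_to_ends_def)
qed

text \<open>The third conjunct serves closed walks: when the first vertex is repeated at the end,
  the tails omit just this repetition.\<close>

lemma awalk_of_vertices:
  assumes "successively (\<lambda>u v. u \<rightarrow>\<^bsub>G\<^esub> v) (u # xs)" "u \<in> verts G"
  shows "awalk u (map arc_between (zip (u # xs) xs)) (last (u # xs)) \<and>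
    awalk_verts u (map arc_between (zip (u # xs) xs)) = u # xs \<and>
    map (tail G) (map arc_between (zip (u # xs) xs)) = butlast (u # xs)"
  using assms
proof (induction xs arbitrary: u)
  case Nil
  then show ?case by (simp add: awalk_Nil_iff)
next
  case (Cons v xs)
  then have uv: "u \<rightarrow>\<^bsub>G\<^esub> v" by simp
  have v: "v \<in> verts G" using arc_between[OF uv] head_in_verts by metis
  show ?case using Cons.IH[OF _ v] Cons.prems uv arc_between[OF uv] by (auto simp: awalk_Cons_iff)
qed

lemma cycle_of_vertices:
  assumes q: "distinct q" "successively (\<lambda>u v. u \<rightarrow>\<^bsub>G\<^esub> v) q" "last q \<rightarrow>\<^bsub>G\<^esub> hd q" "3 \<le> length q"
  shows "\<exists>p. undirected_cycle G p \<and> cycle_verts G p = set q \<and> length p = length q"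
proof -
  obtain u xs where u: "q = u # xs" using q(4) by (cases q) auto
  have uv: "u \<in> verts G" using q(3) adj_in_verts(2) u by auto
  have "successively (\<lambda>u v. u \<rightarrow>\<^bsub>G\<^esub> v) (u # (xs @ [u]))"
    using q(2,3) u by (subst append_Cons[symmetric], subst successively_append_iff) auto
  note w = awalk_of_vertices[OF this uv]
  let ?p = "map arc_between (zip (u # xs @ [u]) (xs @ [u]))"
  have "cycle ?p" unfolding cycle_def
    using w q(1) u by (intro exI[of _ u]) auto
  moreover have "tail G ` set ?p = set q"
  proof -
    have "tail G ` set ?p = set (map (tail G) ?p)" by (simp only: set_map)
    also have "\<dots> = set q" unfolding conjunct2[OF conjunct2[OF w]] u by (simp add: butlast_append)
    finally show ?thesis .
  qed
  moreover have "length ?p = length q" using u by simp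
  ultimately show ?thesis using q(4) unfolding undirected_cycle_def cycle_verts_def
    by (intro exI[of _ ?p]) auto
qed

end

section \<open>Counting chords by ordered pairs\<close>

lemma card_consecutive_on_le:
  "finite {(u, v). consecutive_on G p u v}" "card {(u, v). consecutive_on G p u v} \<le> 2 * length p"
proof -
  let ?T = "(\<lambda>e. (tail G e, head G e)) ` set p" and ?H = "(\<lambda>e. (head G e, tail G e)) ` set p"
  have sub: "{(u, v). consecutive_on G p u v} \<subseteq> ?T \<union> ?H"
    by (auto simp: consecutive_on_def doubleton_eq_iff)
  then show "finite {(u, v). consecutive_on G p u v}" by (rule finite_subset) simp
  have "card {(u, v). consecutive_on G p u v} \<le> card (?T \<union> ?H)"
    using sub by (intro card_mono) auto
  also have "\<dots> \<le> card ?T + card ?H" by (rule card_Un_le)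
  also have "\<dots> \<le> length p + length p"
    by (intro add_mono order.trans[OF card_image_le card_length]) auto
  finally show "card {(u, v). consecutive_on G p u v} \<le> 2 * length p" by simp
qed

lemma card_doubletons_ge:
  assumes "finite R"
  shows "card R \<le> 2 * card ((\<lambda>(u, v). {u, v}) ` R)"
proof -
  let ?f = "\<lambda>(u, v). {u, v}"
  have two: "card {r \<in> R. ?f r = c} \<le> 2" if c: "c \<in> ?f ` R" for c
  proof -
    obtain u v where uv: "c = {u, v}" using c by (auto simp: split_def)
    have "r \<in> {(u, v), (v, u)}" if "?f r = c" for r
    proof -
      obtain a b where r: "r = (a, b)" by (cases r)
      have "{a, b} = {u, v}" using that unfolding r uv by (simp only: prod.case)
      then show ?thesis unfolding r doubleton_eq_iff by blast
    qed
    then have "{r \<in> R. ?f r = c} \<subseteq> {(u, v), (v, u)}" by blast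
    then have "card {r \<in> R. ?f r = c} \<le> card {(u, v), (v, u)}" by (intro card_mono) simp_all
    also have "\<dots> \<le> 2" by (intro card_insert_le_m1) simp_all
    finally show ?thesis .
  qed
  have "card R = card (\<Union>c\<in>?f ` R. {r \<in> R. ?f r = c})" by (rule arg_cong[of _ _ card]) auto
  also have "\<dots> \<le> (\<Sum>c\<in>?f ` R. card {r \<in> R. ?f r = c})" using assms by (intro card_UN_le) simp
  also have "\<dots> \<le> (\<Sum>c\<in>?f ` R. 2)" using two by (rule sum_mono)
  finally show ?thesis by simp
qed

text \<open>Ordered adjacent pairs on the cycle are either consecutive, at most two per arc of
  \<open>p\<close>, or give a chord, at most two per chord.\<close>

lemma card_chords_ge:
  assumes fin: "finite (cycle_verts G p)"
  shows "(\<Sum>u\<in>cycle_verts G p. card {v \<in> cycle_verts G p. u \<rightarrow>\<^bsub>G\<^esub> v}) \<le> 2 * card (chords G p) + 2 * length p"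
proof -
  let ?A = "cycle_verts G p" and ?C = "{(u, v). consecutive_on G p u v}"
  let ?S = "Sigma ?A (\<lambda>u. {v \<in> ?A. u \<rightarrow>\<^bsub>G\<^esub> v})"
  have finS: "finite ?S" using fin by simp
  have ch: "chords G p = (\<lambda>(u, v). {u, v}) ` (?S - ?C)"
    by (fastforce simp: chords_def)
  have "(\<Sum>u\<in>?A. card {v \<in> ?A. u \<rightarrow>\<^bsub>G\<^esub> v}) = card ?S" using fin by simp
  also have "\<dots> \<le> card (?S - ?C) + card ?C"
    using card_Un_le[of "?S - ?C" ?C] card_mono[of "(?S - ?C) \<union> ?C" ?S] finS card_consecutive_on_le(1)[of G p] by auto
  also have "\<dots> \<le> 2 * card (chords G p) + 2 * length p"
    unfolding ch using finS by (intro add_mono card_doubletons_ge card_consecutive_on_le) simp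
  finally show ?thesis .
qed

section \<open>Degrees and connectedness in terms of adjacency\<close>

lemma (in graph) out_degree_eq_card: "out_degree G u = card {v. u \<rightarrow>\<^bsub>G\<^esub> v}"
proof -
  have "bij_betw (head G) (out_arcs G u) {v. u \<rightarrow>\<^bsub>G\<^esub> v}"
    unfolding bij_betw_def
  proof
    show "inj_on (head G) (out_arcs G u)"
      by (rule inj_onI) (auto simp: arc_to_ends_def intro: no_multi_arcs)
    show "head G ` out_arcs G u = {v. u \<rightarrow>\<^bsub>G\<^esub> v}"
      by (auto simp: arcs_ends_def arc_to_ends_def)
  qed
  then show ?thesis by (simp add: out_degree_def bij_betw_same_card)
qed

text \<open>Otherwise \<open>S\<close> would be closed under reachability in the induced subgraph;
  symmetry of the arcs lets every step be read forwards.\<close>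

lemma (in graph) connected_crossing_arc:
  assumes "connected (G \<restriction> B)" "S \<subset> B" "S \<noteq> {}"
  shows "\<exists>u\<in>S. \<exists>v\<in>B - S. u \<rightarrow>\<^bsub>G\<^esub> v"
proof (rule ccontr)
  assume no: "\<not> ?thesis"
  obtain a b where ab: "a \<in> S" "b \<in> B" "b \<notin> S" using assms by blast
  then have "(a, b) \<in> rtrancl_on B ((arcs_ends (G \<restriction> B))\<^sup>s)"
    using assms by (auto simp: connected_conv)
  then have "b \<in> S"
  proof (induction rule: rtrancl_on_induct)
    case base
    then show ?case using ab by simp
  next
    case (step v w)
    then have "v \<rightarrow>\<^bsub>G\<^esub> w \<or> w \<rightarrow>\<^bsub>G\<^esub> v"
      by (auto simp: symcl_def dest: dominates_induce_subgraphD)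
    then have "v \<rightarrow>\<^bsub>G\<^esub> w" using sym_arcs by (auto simp: symmetric_def dest: symD)
    then show ?case using no step by blast
  qed
  then show False using ab by simp
qed

theorem theorem1p11:
  fixes G :: "('a, 'b) pre_digraph" and z :: 'a and d :: nat
  assumes "d \<ge> 3"
    and "graph G"
    and "k_connected 2 G"
    and "z \<in> verts G"
    and "card (verts G) \<ge> 2 * d + 1"
    and "\<And>v. v \<in> verts G - {z} \<Longrightarrow> out_degree G v \<ge> d"
  shows "\<exists>p. undirected_cycle G p \<and> card (chords G p) \<ge> d * (d - 2)"
proof -
  interpret graph G by fact
  interpret sym_adjacency "\<lambda>u v. u \<rightarrow>\<^bsub>G\<^esub> v"
  proof
    show "u \<rightarrow>\<^bsub>G\<^esub> v \<longleftrightarrow> v \<rightarrow>\<^bsub>G\<^esub> u" for u v using sym_arcs by (auto simp: symmetric_def dest: symD)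
    show "\<not> v \<rightarrow>\<^bsub>G\<^esub> v" for v using no_loops by (auto simp: arcs_ends_def arc_to_ends_def)
  qed
  obtain q where q: "is_path q" "set q \<subseteq> verts G" "3 \<le> length q" "last q \<rightarrow>\<^bsub>G\<^esub> hd q"
    and deg: "2 * int (card (set q)) + 2 * int d * (int d - 2) \<le> (\<Sum>u\<in>set q. int (card (nbrs u \<inter> set q))) + 1"
  proof (rule exE[OF ex_cycle_degree_sum_ge[of "verts G" z d]])
    show "finite (verts G)" by simp
    show "u \<in> verts G" if "u \<rightarrow>\<^bsub>G\<^esub> v" for u v using that by (rule adj_in_verts)
    show "d \<le> card (nbrs v)" if "v \<in> verts G" "v \<noteq> z" for v
      using assms(6)[of v] that by (simp add: out_degree_eq_card nbrs_def)
    show "\<exists>u\<in>S. \<exists>v\<in>verts G - {y} - S. u \<rightarrow>\<^bsub>G\<^esub> v"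
      if "y \<in> verts G" "S \<subset> verts G - {y}" "S \<noteq> {}" for y S
    proof (rule connected_crossing_arc)
      show "connected (G \<restriction> (verts G - {y}))"
        using assms(3) that(1) by (simp add: k_connected_def)
    qed (use that in auto)
  qed (use assms that in auto)
  obtain p where p: "undirected_cycle G p" "cycle_verts G p = set q" "length p = length q"
    using cycle_of_vertices[of q] q unfolding is_path_def by blast
  have "nbrs u \<inter> set q = {v \<in> set q. u \<rightarrow>\<^bsub>G\<^esub> v}" for u by (auto simp: nbrs_def)
  then have "(\<Sum>u\<in>set q. card (nbrs u \<inter> set q)) \<le> 2 * card (chords G p) + 2 * card (set q)"
    using card_chords_ge[of G p] p q(1) by (simp add: is_path_length)
  then have "(\<Sum>u\<in>set q. int (card (nbrs u \<inter> set q))) \<le> 2 * int (card (chords G p)) + 2 * int (card (set q))"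
    by (simp flip: of_nat_sum)
  moreover have "2 * int d * (int d - 2) = 2 * int (d * (d - 2))"
    using assms(1) by (simp add: of_nat_diff)
  ultimately have "2 * int (d * (d - 2)) \<le> 2 * int (card (chords G p)) + 1"
    using deg by linarith
  \<comment> \<open>Both doubled quantities are even, so the extra 1 disappears.\<close>
  then have "d * (d - 2) \<le> card (chords G p)" by presburger
  then show ?thesis using p by blast
qed

end
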